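(* Let $\mathcal{J}=\mathcal{J}_0+\varphi:\mathbb{R}^{M,m}\times\mathbb{R}^M\to\mathbb{R}\cup\{\infty\}$ with $$\mathcal{J}_0(u,d)=\int_{\Omega,h}\psi(\varepsilon(u),d)\,dV+\int_\Omega g_c\,\gamma(d,\nabla d)\,dV+P_{\mathrm{ext}}(u),\qquad \varphi(d)=\sum_{i=1}^M I_{[d_n(p_i),1]}(d_i),$$ and for $j=1,\dots,M$ let $V_{2j-1}$ be the $m$-dimensional subspace of $\mathbb{R}^{M,m}\times\mathbb{R}^M$ of vectors whose only possibly nonzero entries are the displacement components at node $p_j$, and $V_{2j}$ the one-dimensional subspace of vectors whose only possibly nonzero entry is the damage component at $p_j$. Let $U\in\operatorname{dom}\mathcal{J}=\{W:\mathcal{J}(W)<\infty\}$ be stationary in the sense that $$\mathcal{J}(U)\le\mathcal{J}(U+V)\qquad\forall\, V\in V_i,\ \forall\, i=1,\dots,2M.$$ Then $U$ is first-order optimal in the sense that $$\langle\nabla\mathcal{J}_0(U),W-U\rangle\ge0\qquad\forall\, W\in\operatorname{dom}\mathcal{J}.$$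
   Context: **Energy density.** $\mathbb{S}^m$ is the space of real symmetric $m\times m$ matrices with Frobenius norm $|\cdot|_F$. Fix $\mu>0$, $\lambda>-\tfrac23\mu$ and $\psi_0(\varepsilon)=\frac{\lambda}{2}(\operatorname{tr}\varepsilon)^2+\mu\operatorname{tr}(\varepsilon^2)$, assumed strongly convex on $\mathbb{S}^m$ (automatic for $m\le 3$). Let $g:[0,1]\to[0,1]$ be convex, $C^2$ (one-sided derivatives at endpoints), monotone decreasing, $g(0)=1$, $g(1)=0$; let $k>0$. Put $\psi(\varepsilon,d)=[g(d)+k]\psi_0^+(\varepsilon)+(1+k)\psi_0^-(\varepsilon)$ for $\varepsilon\in\mathbb{S}^m$, $d\in[0,1]$. With $\langle x\rangle_+=\max\{0,x\}$, $\langle x\rangle_-=\min\{0,x\}$, $\operatorname{dev}\varepsilon=\varepsilon-\frac{\operatorname{tr}\varepsilon}{m}I$, the pair $(\psi_0^+,\psi_0^-)$ is one of: (a) $\psi_0^+=\psi_0$, $\psi_0^-=0$; (b) $\psi_0^+=(\frac{\mu}{m}+\frac{\lambda}{2})(\operatorname{tr}\varepsilon)^2$, $\psi_0^-=\mu\operatorname{dev}\varepsilon:\operatorname{dev}\varepsilon$; (c) $\psi_0^+=(\frac{\mu}{m}+\frac{\lambda}{2})\langle\operatorname{tr}\varepsilon\rangle_+^2$, $\psi_0^-=(\frac{\mu}{m}+\frac{\lambda}{2})\langle\operatorname{tr}\varepsilon\rangle_-^2+\mu\operatorname{dev}\varepsilon:\operatorname{dev}\varepsilon$; (d) (only if $\lambda\ge0$)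 $\psi_0^\pm=\frac{\lambda}{2}\langle\sum_i\lambda_i(\varepsilon)\rangle_\pm^2+\mu\sum_i\langle\lambda_i(\varepsilon)\rangle_\pm^2$, where $\lambda_i(\varepsilon)$ are the eigenvalues of $\varepsilon$. **Crack surface density.** $\gamma(d,\nabla d)=\frac{1}{4c_w}\big(\frac{w(d)}{l}+l|\nabla d|^2\big)$ with $l>0$, $w(d)=(1+\beta(1-d))d$, $\beta\in[-1,0]$, $c_w=\int_0^1\sqrt{w(s)}\,ds$; $g_c>0$ is a constant. **Discretization.** $\Omega\subset\mathbb{R}^m$ is a bounded polyhedral domain with a conforming finite element grid $\mathcal{G}$, with nodes $p_1,\dots,p_M$ and first-order Lagrange nodal basis $\theta_1,\dots,\theta_M$. Finite element functions $u:\Omega\to\mathbb{R}^m$, $d:\Omega\to\mathbb{R}$ are identified with their nodal coefficients $u\in\mathbb{R}^{M,m}$, $d\in\mathbb{R}^M$, and $\varepsilon(u)=\frac12(\nabla u+\nabla u^T)$. For $f$ on $\Omega$, $\int_{\Omega,h}f\,dV=\sum_{e\in\mathcal{G}}\sum_{\alpha=1}^{\alpha_{\max}}f(q_{e,\alpha})\omega_{e,\alpha}$ is a quadrature rule with points $q_{e,\alpha}\in e$ and positive weights, which on each element integrates $|\varepsilon(u)|_F^2$ exactly for every finite element function $u$. $P_{\mathrm{ext}}$ is a linear functional of $u$. The previous damage $d_n$ has nodal values $d_n(p_i)\in[0,1]$. $I_K$ is $0$ on $K$ and $\infty$ elsewhere, and $\mathcal{J}(u,d)=\infty$ wherever $\varphi(d)=\infty$.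 No Dirichlet conditions are imposed. $\langle\cdot,\cdot\rangle$ is the Euclidean pairing; derivatives of $\mathcal{J}_0$ at points where damage values equal $0$ or $1$ are understood via the one-sided derivatives of $g$. *)

theory Defs
  imports "HOL-Analysis.Analysis" "HOL-Computational_Algebra.Polynomial"
begin

section \<open>Energy density\<close>

text \<open>On \<open>real^'m^'m\<close> the library's \<open>norm\<close> and \<open>\<bullet>\<close> are the Frobenius norm and the
  Frobenius product \<open>A : B\<close>.\<close>

definition sym_matrices :: "(real^'m^'m) set" where
  "sym_matrices = {A. transpose A = A}"

definition strongly_convex_on :: "'a::real_normed_vector set \<Rightarrow> ('a \<Rightarrow> real) \<Rightarrow> bool" where
  "strongly_convex_on S f \<longleftrightarrow> convex S \<and>
     (\<exists>c>0. \<forall>x\<in>S. \<forall>y\<in>S. \<forall>t\<in>{0..1}.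
        f ((1 - t) *\<^sub>R x + t *\<^sub>R y)
          \<le> (1 - t) * f x + t * f y - c / 2 * t * (1 - t) * (norm (x - y))\<^sup>2)"

text \<open>Derivatives within \<open>{0..1}\<close> are one-sided at the two endpoints.\<close>

definition C2_on_unit_interval :: "(real \<Rightarrow> real) \<Rightarrow> bool" where
  "C2_on_unit_interval g \<longleftrightarrow>
     (\<exists>g' g''. (\<forall>x\<in>{0..1}. (g has_real_derivative g' x) (at x within {0..1}) \<and>
                          (g' has_real_derivative g'' x) (at x within {0..1})) \<and>
              continuous_on {0..1} g'')"

definition degradation_function :: "(real \<Rightarrow> real) \<Rightarrow> bool" where
  "degradation_function g \<longleftrightarrow>
     g ` {0..1} \<subseteq> {0..1} \<and> convex_on {0..1} g \<and> C2_on_unit_interval g \<and>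
     antimono_on {0..1} g \<and> g 0 = 1 \<and> g 1 = 0"

definition pos_part :: "real \<Rightarrow> real" where "pos_part x = max 0 x"

definition neg_part :: "real \<Rightarrow> real" where "neg_part x = min 0 x"

definition dev :: "real^'m^'m \<Rightarrow> real^'m^'m" where
  "dev A = A - (trace A / real CARD('m)) *\<^sub>R mat 1"

text \<open>The multiset of real roots of \<open>det (X I - A)\<close>, that is, the eigenvalues counted with
  algebraic multiplicity (all \<open>m\<close> of them when \<open>A\<close> is symmetric).\<close>

definition eigenvalues :: "real^'m^'m \<Rightarrow> real multiset" where
  "eigenvalues A = proots (det (\<chi> i j. if i = j then [:- A$i$j, 1:] else [:- A$i$j:]))"

definition psi0 :: "real \<Rightarrow> real \<Rightarrow> real^'m^'m \<Rightarrow> real" where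
  "psi0 lam mu A = lam / 2 * (trace A)\<^sup>2 + mu * trace (A ** A)"

datatype energy_split = No_Split | Vol_Dev | Vol_Dev_Unilateral | Spectral

fun psi0_plus :: "energy_split \<Rightarrow> real \<Rightarrow> real \<Rightarrow> real^'m^'m \<Rightarrow> real" where
  "psi0_plus No_Split lam mu A = psi0 lam mu A"
| "psi0_plus Vol_Dev lam mu A = (mu / real CARD('m) + lam / 2) * (trace A)\<^sup>2"
| "psi0_plus Vol_Dev_Unilateral lam mu A =
     (mu / real CARD('m) + lam / 2) * (pos_part (trace A))\<^sup>2"
| "psi0_plus Spectral lam mu A =
     lam / 2 * (pos_part (\<Sum>x\<in>#eigenvalues A. x))\<^sup>2 + mu * (\<Sum>x\<in>#eigenvalues A. (pos_part x)\<^sup>2)"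

fun psi0_minus :: "energy_split \<Rightarrow> real \<Rightarrow> real \<Rightarrow> real^'m^'m \<Rightarrow> real" where
  "psi0_minus No_Split lam mu A = 0"
| "psi0_minus Vol_Dev lam mu A = mu * (dev A \<bullet> dev A)"
| "psi0_minus Vol_Dev_Unilateral lam mu A =
     (mu / real CARD('m) + lam / 2) * (neg_part (trace A))\<^sup>2 + mu * (dev A \<bullet> dev A)"
| "psi0_minus Spectral lam mu A =
     lam / 2 * (neg_part (\<Sum>x\<in>#eigenvalues A. x))\<^sup>2 + mu * (\<Sum>x\<in>#eigenvalues A. (neg_part x)\<^sup>2)"

definition energy_density ::
  "energy_split \<Rightarrow> real \<Rightarrow> real \<Rightarrow> (real \<Rightarrow> real) \<Rightarrow> real \<Rightarrow> real^'m^'m \<Rightarrow> real \<Rightarrow> real" where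
  "energy_density sp lam mu g k A d =
     (g d + k) * psi0_plus sp lam mu A + (1 + k) * psi0_minus sp lam mu A"

section \<open>Crack surface density\<close>

definition local_dissipation :: "real \<Rightarrow> real \<Rightarrow> real" where
  "local_dissipation \<beta> d = (1 + \<beta> * (1 - d)) * d"

definition c_w :: "real \<Rightarrow> real" where
  "c_w \<beta> = integral {0..1} (\<lambda>s. sqrt (local_dissipation \<beta> s))"

definition crack_density :: "real \<Rightarrow> real \<Rightarrow> real \<Rightarrow> 'a::real_normed_vector \<Rightarrow> real" where
  "crack_density \<beta> l d G = 1 / (4 * c_w \<beta>) * (local_dissipation \<beta> d / l + l * (norm G)\<^sup>2)"

section \<open>First-order finite elements\<close>

definition polyhedral_domain :: "(real^'m) set \<Rightarrow> bool" where
  "polyhedral_domain \<Omega> \<longleftrightarrow> \<Omega> \<noteq> {} \<and> open \<Omega> \<and> connected \<Omega> \<and> bounded \<Omega> \<and>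
     (\<exists>\<P>. finite \<P> \<and> (\<forall>P\<in>\<P>. polytope P) \<and> frontier \<Omega> = \<Union>\<P>)"

text \<open>Grid elements are closed sets parametrized over a reference simplex or a reference cube.\<close>

datatype ref_shape = Simplex | Cube

fun ref_vertices :: "ref_shape \<Rightarrow> (real^'m) set" where
  "ref_vertices Simplex = insert 0 (range (\<lambda>i. axis i 1))"
| "ref_vertices Cube = {x. \<forall>i. x$i \<in> {0, 1}}"

definition ref_element :: "ref_shape \<Rightarrow> (real^'m) set" where
  "ref_element s = convex hull (ref_vertices s)"

text \<open>First-order shape functions: affine functions (P1) on the simplex, multi-affine functions
  (Q1) on the cube.\<close>

fun shape_function :: "ref_shape \<Rightarrow> (real^'m \<Rightarrow> real) \<Rightarrow> bool" where
  "shape_function Simplex v \<longleftrightarrow> (\<exists>a b. \<forall>x. v x = a \<bullet> x + b)"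
| "shape_function Cube v \<longleftrightarrow>
     (\<exists>c :: 'm set \<Rightarrow> real. \<forall>x. v x = (\<Sum>S\<in>UNIV. c S * (\<Prod>i\<in>S. x$i)))"

definition element_map :: "ref_shape \<Rightarrow> (real^'m \<Rightarrow> real^'m) \<Rightarrow> bool" where
  "element_map s F \<longleftrightarrow> (\<forall>i. shape_function s (\<lambda>x. F x $ i)) \<and> inj_on F (ref_element s) \<and>
     (\<forall>x\<in>ref_element s. det (jacobian F (at x)) \<noteq> 0)"

text \<open>\<open>T e\<close> and \<open>F e\<close> are the reference shape and the parametrization of the element \<open>e\<close>. Distinct
  elements meet in a common (possibly empty) proper face with common vertices.\<close>

definition conforming_grid ::
  "(real^'m) set \<Rightarrow> (real^'m) set set \<Rightarrow> ((real^'m) set \<Rightarrow> ref_shape) \<Rightarrow>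
   ((real^'m) set \<Rightarrow> real^'m \<Rightarrow> real^'m) \<Rightarrow> bool" where
  "conforming_grid \<Omega> \<G> T F \<longleftrightarrow> finite \<G> \<and> closure \<Omega> = \<Union>\<G> \<and>
     (\<forall>e\<in>\<G>. element_map (T e) (F e) \<and> e = F e ` ref_element (T e)) \<and>
     (\<forall>e\<in>\<G>. \<forall>e'\<in>\<G>. e \<noteq> e' \<longrightarrow>
        (\<exists>f f'. f face_of ref_element (T e) \<and> f \<noteq> ref_element (T e) \<and>
                f' face_of ref_element (T e') \<and> f' \<noteq> ref_element (T e') \<and>
                e \<inter> e' = F e ` f \<and> e \<inter> e' = F e' ` f' \<and>
                F e ` (f \<inter> ref_vertices (T e)) = F e' ` (f' \<inter> ref_vertices (T e'))))"

definition fe_function ::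
  "(real^'m) set \<Rightarrow> (real^'m) set set \<Rightarrow> ((real^'m) set \<Rightarrow> ref_shape) \<Rightarrow>
   ((real^'m) set \<Rightarrow> real^'m \<Rightarrow> real^'m) \<Rightarrow> (real^'m \<Rightarrow> real) \<Rightarrow> bool" where
  "fe_function \<Omega> \<G> T F v \<longleftrightarrow> continuous_on (closure \<Omega>) v \<and>
     (\<forall>e\<in>\<G>. \<exists>w. shape_function (T e) w \<and> (\<forall>x\<in>ref_element (T e). v (F e x) = w x))"

definition lagrange_basis ::
  "(real^'m) set \<Rightarrow> (real^'m) set set \<Rightarrow> ((real^'m) set \<Rightarrow> ref_shape) \<Rightarrow>
   ((real^'m) set \<Rightarrow> real^'m \<Rightarrow> real^'m) \<Rightarrow> ('M \<Rightarrow> real^'m) \<Rightarrow> ('M \<Rightarrow> real^'m \<Rightarrow> real) \<Rightarrow> bool" where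
  "lagrange_basis \<Omega> \<G> T F p \<theta> \<longleftrightarrow>
     inj p \<and> range p = (\<Union>e\<in>\<G>. F e ` ref_vertices (T e)) \<and>
     (\<forall>i. fe_function \<Omega> \<G> T F (\<theta> i) \<and> (\<forall>j. \<theta> i (p j) = (if i = j then 1 else 0)))"

definition fe_fun :: "('M::finite \<Rightarrow> 'x \<Rightarrow> real) \<Rightarrow> 'a::real_vector^'M \<Rightarrow> 'x \<Rightarrow> 'a" where
  "fe_fun \<theta> c x = (\<Sum>i\<in>UNIV. \<theta> i x *\<^sub>R c$i)"

definition gradient :: "('a::real_inner \<Rightarrow> real) \<Rightarrow> 'a filter \<Rightarrow> 'a" where
  "gradient f net = (THE G. (f has_derivative (\<lambda>h. G \<bullet> h)) net)"

definition strain ::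
  "('M::finite \<Rightarrow> real^'m \<Rightarrow> real) \<Rightarrow> real^'m^'M \<Rightarrow> (real^'m) filter \<Rightarrow> real^'m^'m" where
  "strain \<theta> u net =
     (1/2) *\<^sub>R (jacobian (fe_fun \<theta> u) net + transpose (jacobian (fe_fun \<theta> u) net))"

text \<open>Quadrature points may lie on element boundaries, where the gradient of a finite element
  function depends on the element. Hence strains are evaluated as derivatives within the element.\<close>

definition quadrature_rule ::
  "(real^'m) set set \<Rightarrow> ('M::finite \<Rightarrow> real^'m \<Rightarrow> real) \<Rightarrow> nat \<Rightarrow>
   ((real^'m) set \<Rightarrow> nat \<Rightarrow> real^'m) \<Rightarrow> ((real^'m) set \<Rightarrow> nat \<Rightarrow> real) \<Rightarrow> bool" where
  "quadrature_rule \<G> \<theta> amax q \<omega> \<longleftrightarrow>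
     (\<forall>e\<in>\<G>. \<forall>\<alpha>\<in>{1..amax}. q e \<alpha> \<in> e \<and> 0 < \<omega> e \<alpha>) \<and>
     (\<forall>e\<in>\<G>. \<forall>u :: real^'m^'M.
        (\<Sum>\<alpha>=1..amax. (norm (strain \<theta> u (at (q e \<alpha>) within e)))\<^sup>2 * \<omega> e \<alpha>) =
        (LINT x:e|lebesgue. (norm (strain \<theta> u (at x within e)))\<^sup>2))"

section \<open>The incremental functional\<close>

definition J0 ::
  "(real^'m^'m \<Rightarrow> real \<Rightarrow> real) \<Rightarrow> (real \<Rightarrow> real^'m \<Rightarrow> real) \<Rightarrow> real \<Rightarrow>
   (real^'m) set \<Rightarrow> (real^'m) set set \<Rightarrow> ('M::finite \<Rightarrow> real^'m \<Rightarrow> real) \<Rightarrow> nat \<Rightarrow>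
   ((real^'m) set \<Rightarrow> nat \<Rightarrow> real^'m) \<Rightarrow> ((real^'m) set \<Rightarrow> nat \<Rightarrow> real) \<Rightarrow>
   (real^'m^'M \<Rightarrow> real) \<Rightarrow> (real^'m^'M) \<times> (real^'M) \<Rightarrow> real" where
  "J0 \<psi> \<gamma> gc \<Omega> \<G> \<theta> amax q \<omega> Pext = (\<lambda>(u, d).
     (\<Sum>e\<in>\<G>. \<Sum>\<alpha>=1..amax.
        \<psi> (strain \<theta> u (at (q e \<alpha>) within e)) (fe_fun \<theta> d (q e \<alpha>)) * \<omega> e \<alpha>) +
     (LINT x:\<Omega>|lebesgue. gc * \<gamma> (fe_fun \<theta> d x) (gradient (fe_fun \<theta> d) (at x))) +
     Pext u)"

definition indicator_functional :: "'a set \<Rightarrow> 'a \<Rightarrow> ereal" where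
  "indicator_functional K x = (if x \<in> K then 0 else \<infinity>)"

definition irreversibility :: "(real^'M::finite) \<Rightarrow> real^'M \<Rightarrow> ereal" where
  "irreversibility dn d = (\<Sum>i\<in>UNIV. indicator_functional {dn$i..1} (d$i))"

text \<open>Where the second summand is infinite, so is the sum, whatever the value of the first one.\<close>

definition functional_J ::
  "('u \<times> (real^'M::finite) \<Rightarrow> real) \<Rightarrow> real^'M \<Rightarrow> 'u \<times> (real^'M) \<Rightarrow> ereal" where
  "functional_J f dn = (\<lambda>(u, d). ereal (f (u, d)) + irreversibility dn d)"

definition effective_domain :: "('a \<Rightarrow> ereal) \<Rightarrow> 'a set" where
  "effective_domain J = {W. J W < \<infinity>}"

text \<open>The subspaces \<open>V\<^sub>2\<^sub>j\<^sub>-\<^sub>1\<close> and \<open>V\<^sub>2\<^sub>j\<close> belonging to node \<open>j\<close>, as two families over the nodes.\<close>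

definition V_displacement :: "'M::finite \<Rightarrow> ((real^'m^'M) \<times> (real^'M)) set" where
  "V_displacement j = {(v, s). (\<forall>i. i \<noteq> j \<longrightarrow> v$i = 0) \<and> s = 0}"

definition V_damage :: "'M::finite \<Rightarrow> ((real^'m^'M) \<times> (real^'M)) set" where
  "V_damage j = {(v, s). v = 0 \<and> (\<forall>i. i \<noteq> j \<longrightarrow> s$i = 0)}"

text \<open>The configurations with nodal damage in \<open>[0, 1]\<close>. Since \<open>g\<close> is given on \<open>[0, 1]\<close> only,
  derivatives of \<open>J0\<close> are taken within this set; at damage values 0 and 1 they are one-sided. The
  set is convex with nonempty interior, so such derivatives are unique.\<close>

definition damage_box :: "('u \<times> (real^'M::finite)) set" where
  "damage_box = {(u, d). \<forall>i. d$i \<in> {0..1}}"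

end

theory Submission
  imports Defs
begin

text \<open>The functional \<open>\<J>\<close> is the sum of \<open>\<J>\<^sub>0\<close> and a constraint that is separable over the nodes:
  finiteness of \<open>\<J>\<close> means that every nodal damage lies in its own interval. Hence if \<open>W\<close> is
  admissible, then \<open>W - U\<close> is the sum of its nodal displacement blocks and its nodal damage
  entries, and moving from \<open>U\<close> along any single one of these summands stays admissible.
  Stationarity on the subspaces makes the one-sided derivative of \<open>\<J>\<^sub>0\<close> along each summand
  nonnegative. If \<open>\<J>\<^sub>0\<close> is differentiable, its derivative is linear, so these finitely many
  inequalities add up to the claim (\<open>blockwise_stationary_imp_first_order\<close>). For a nonsmooth
  \<open>\<J>\<^sub>0\<close> this last step would fail, so the substance of the proof is that \<open>\<J>\<^sub>0\<close> is differentiable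
  within the set of admissible damage values (\<open>J0_differentiable\<close>). It rests on three facts.

  First, the elastic energies are differentiable on symmetric matrices. The only split where this
  is not visible is the spectral one, as eigenvalues are not differentiable where they coincide.
  However, diagonalizing \<open>A\<close> shows that the sum of the squares of its positive eigenvalues is the
  squared Frobenius distance of \<open>A\<close> to the convex cone of negative semidefinite matrices
  (\<open>symmetric_matrix_eigenvalue_sums\<close>), and the squared distance to a closed convex set is
  differentiable everywhere (\<open>has_derivative_sq_dist_closest_point\<close>).

  Second, at each quadrature point the strain depends linearly on the nodal displacements
  (\<open>linear_strain\<close>), and the damage is a shape function value, hence lies in \<open>[0, 1]\<close> when the nodal
  damages do (\<open>fe_fun_in_convex\<close>). The former needs that finite element functions have exactly one
  derivative within a possibly curved element, at its boundary points as well; this is inherited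
  from the reference element, a convex body, through the parametrization of the element.

  Third, the crack energy is a quadratic polynomial in the nodal damages
  (\<open>crack_energy_quadratic\<close>). The integrand is one almost everywhere, with coefficients that are
  continuous on each closed element and therefore integrable.\<close>

section \<open>Derivatives and gradients within convex bodies\<close>

text \<open>Two derivatives at \<open>x\<close> agree along all segments from \<open>x\<close> to points of \<open>S\<close>. Since \<open>S\<close> contains
  a ball, differences of such directions already span the space. The point \<open>x\<close> may be a boundary
  point, as happens for quadrature points and for damage values 0 and 1.\<close>

lemma has_derivative_within_convex_unique:
  fixes f :: "'a::real_normed_vector \<Rightarrow> 'b::real_normed_vector"
  assumes S: "convex S" "interior S \<noteq> {}" "x \<in> S"
    and D: "(f has_derivative D) (at x within S)" and D': "(f has_derivative D') (at x within S)"
  shows "D = D'"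
proof -
  define E where "E = (\<lambda>h. D h - D' h)"
  have E: "((\<lambda>_. 0) has_derivative E) (at x within S)"
    using has_derivative_diff[OF D D'] by (simp add: E_def)
  interpret E: bounded_linear E using E by (rule has_derivative_bounded_linear)
  have dir: "E (y - x) = 0" if y: "y \<in> S" for y
  proof -
    let ?l = "\<lambda>t::real. x + t *\<^sub>R (y - x)"
    have sub: "?l ` {0..1} \<subseteq> S"
    proof clarify
      fix t :: real assume "t \<in> {0..1}"
      then have "(1 - t) *\<^sub>R x + t *\<^sub>R y \<in> S" using S y by (intro convexD) auto
      then show "?l t \<in> S" by (simp add: algebra_simps)
    qed
    have l: "(?l has_derivative (\<lambda>t. t *\<^sub>R (y - x))) (at 0 within {0..1})"
      by (auto intro!: derivative_eq_intros)
    have "((\<lambda>_. 0) has_derivative E) (at (?l 0) within ?l ` {0..1})"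
      using has_derivative_subset[OF E sub] by simp
    from diff_chain_within[OF l this]
    have "((\<lambda>_. 0) has_vector_derivative E (y - x)) (at (0::real) within {0..1})"
      by (simp add: o_def has_vector_derivative_def E.scaleR)
    moreover have "((\<lambda>_. 0) has_vector_derivative (0::'b)) (at (0::real) within {0..1})"
      by (rule has_vector_derivative_const)
    ultimately show ?thesis
      by (metis vector_derivative_unique_within_closed_interval atLeastAtMost_iff box_real(2)
          order.refl zero_le_one zero_less_one)
  qed
  obtain z r where r: "r > 0" "ball z r \<subseteq> S"
    using S(2) by (meson equals0I mem_interior)
  have "E h = 0" for h
  proof (cases "h = 0")
    case False
    define t where "t = r / 2 / norm h"
    have t: "t > 0" using r False by (simp add: t_def)
    have "z + t *\<^sub>R h \<in> ball z r" "z \<in> ball z r"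
      using r False by (simp_all add: t_def dist_norm)
    then have "z + t *\<^sub>R h \<in> S" "z \<in> S" using r by blast+
    then have "E (z + t *\<^sub>R h - x) - E (z - x) = 0" by (metis dir diff_self)
    then have "t *\<^sub>R E h = 0" by (simp add: E.add E.diff E.scaleR)
    then show ?thesis using t by simp
  qed (simp add: E.zero)
  then show ?thesis by (auto simp: E_def fun_eq_iff)
qed

text \<open>The gradient is defined by unique description, so identifying it takes uniqueness of the
  derivative and not only its existence.\<close>

lemma gradient_eq_within_convex:
  fixes f :: "'a::euclidean_space \<Rightarrow> real"
  assumes S: "convex S" "interior S \<noteq> {}" "x \<in> S"
    and G: "(f has_derivative (\<lambda>h. G \<bullet> h)) (at x within S)"
  shows "gradient f (at x within S) = G"
  unfolding gradient_def
proof (rule the_equality)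
  show "(f has_derivative (\<lambda>h. G \<bullet> h)) (at x within S)" by (rule G)
  fix G' assume "(f has_derivative (\<lambda>h. G' \<bullet> h)) (at x within S)"
  from has_derivative_within_convex_unique[OF S this G] show "G' = G"
    by (metis vector_eq_rdot)
qed

lemma damage_box_convex_body:
  "convex (damage_box :: ('u::euclidean_space \<times> (real^'M::finite)) set)"
  "interior (damage_box :: ('u::euclidean_space \<times> (real^'M::finite)) set) \<noteq> {}"
proof -
  have eq: "(damage_box :: ('u \<times> (real^'M)) set) = UNIV \<times> cbox 0 1"
    by (auto simp: damage_box_def mem_box_cart)
  show "convex (damage_box :: ('u \<times> (real^'M)) set)"
    unfolding eq by (intro convex_Times) auto
  have "(\<chi> i. 1/2) \<in> box 0 (1 :: real^'M)" by (simp add: mem_box_cart)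
  then show "interior (damage_box :: ('u \<times> (real^'M)) set) \<noteq> {}"
    unfolding eq interior_Times by (auto simp: interior_cbox)
qed

section \<open>Diagonalization of symmetric matrices\<close>

text \<open>A maximizer \<open>v\<close> of \<open>x \<bullet> f x\<close> over the unit sphere of \<open>S\<close> is an eigenvector: the form
  \<open>c (x \<bullet> x) - x \<bullet> f x\<close> with \<open>c = v \<bullet> f v\<close> is nonnegative on \<open>S\<close> and vanishes at \<open>v\<close>, so its first
  variation at \<open>v\<close> in the direction \<open>f v - c v\<close> is zero.\<close>

lemma selfadjoint_eigenvector_in_invariant_subspace:
  fixes f :: "'a::euclidean_space \<Rightarrow> 'a"
  assumes f: "linear f" "\<And>x y. f x \<bullet> y = x \<bullet> f y"
    and S: "subspace S" "f ` S \<subseteq> S" "S \<noteq> {0}"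
  shows "\<exists>v c. v \<in> S \<and> norm v = 1 \<and> f v = c *\<^sub>R v"
proof -
  interpret f: linear f by fact
  let ?K = "S \<inter> sphere 0 1"
  have "compact ?K" using S(1) by (simp add: closed_subspace closed_Int_compact)
  moreover have "?K \<noteq> {}"
  proof -
    obtain x where "x \<in> S" "x \<noteq> 0" using S(1,3) subspace_0 by blast
    then have "(1 / norm x) *\<^sub>R x \<in> ?K" using S(1) by (simp add: subspace_scale)
    then show ?thesis by blast
  qed
  moreover have "continuous_on ?K (\<lambda>x. x \<bullet> f x)"
    using f(1) by (intro continuous_intros linear_continuous_on) (simp add: linear_linear)
  ultimately obtain v where v: "v \<in> ?K" and max: "\<And>x. x \<in> ?K \<Longrightarrow> x \<bullet> f x \<le> v \<bullet> f v"
    using continuous_attains_sup by metis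
  define c where "c = v \<bullet> f v"
  define Q where "Q x = c * (x \<bullet> x) - x \<bullet> f x" for x
  have Qnn: "Q x \<ge> 0" if "x \<in> S" for x
  proof (cases "x = 0")
    case False
    then have "(1 / norm x) *\<^sub>R x \<in> ?K" using S(1) that by (simp add: subspace_scale)
    from max[OF this] have "(x \<bullet> f x) / (norm x)\<^sup>2 \<le> c"
      by (simp add: f.scale c_def power2_eq_square)
    then show ?thesis using False by (simp add: Q_def power2_norm_eq_inner field_simps)
  qed (simp add: Q_def f.zero)
  define y where "y = f v - c *\<^sub>R v"
  have yS: "y \<in> S" using v S by (auto simp: y_def subspace_diff subspace_scale)
  have "y = 0"
  proof (rule ccontr)
    assume "y \<noteq> 0"
    then have n: "y \<bullet> y > 0" by simp
    \<comment> \<open>A step so short that the linear decrease \<open>2 t (y \<bullet> y)\<close> of the form beats its quadratic part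
      \<open>t\<^sup>2 Q y\<close>.\<close>
    define t where "t = (y \<bullet> y) / (Q y + 1)"
    have Qy: "Q y \<ge> 0" using Qnn yS by simp
    have t: "t > 0" using n Qy by (simp add: t_def)
    have "v \<bullet> v = 1" "v \<bullet> f y = y \<bullet> f v"
      using v f(2)[of y v] by (simp_all add: dot_square_norm inner_commute)
    then have "Q (v + t *\<^sub>R y) = t * (t * Q y - 2 * (y \<bullet> f v - c * (y \<bullet> v)))"
      using inner_commute[of v y]
      by (simp add: Q_def f.add f.scale inner_add_left inner_add_right c_def[symmetric] algebra_simps)
    also have "y \<bullet> f v - c * (y \<bullet> v) = y \<bullet> y"
      by (simp add: y_def inner_simps)
    finally have "t * (t * Q y - 2 * (y \<bullet> y)) \<ge> 0"
      using Qnn[of "v + t *\<^sub>R y"] v yS S(1) by (simp add: subspace_add subspace_scale)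
    then have "t * Q y \<ge> 2 * (y \<bullet> y)" using t by (simp add: zero_le_mult_iff)
    moreover have "t * Q y \<le> y \<bullet> y"
      using Qy n by (simp add: t_def field_simps)
    ultimately show False using n by simp
  qed
  then show ?thesis using v by (intro exI[of _ v] exI[of _ c]) (auto simp: y_def)
qed

text \<open>Split off one eigenvector; its orthogonal complement in \<open>S\<close> is again invariant because \<open>f\<close> is
  self-adjoint.\<close>

lemma selfadjoint_eigenbasis_of_invariant_subspace:
  fixes f :: "'a::euclidean_space \<Rightarrow> 'a"
  assumes f: "linear f" "\<And>x y. f x \<bullet> y = x \<bullet> f y"
    and "subspace S" "f ` S \<subseteq> S"
  shows "\<exists>B. pairwise orthogonal B \<and> (\<forall>x\<in>B. norm x = 1 \<and> (\<exists>c. f x = c *\<^sub>R x)) \<and> span B = S"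
  using assms(3,4)
proof (induction "dim S" arbitrary: S rule: less_induct)
  case (less S)
  show ?case
  proof (cases "S = {0}")
    case True
    then show ?thesis by (intro exI[of _ "{}"]) auto
  next
    case False
    with less.prems obtain v c where v: "v \<in> S" "norm v = 1" "f v = c *\<^sub>R v"
      using selfadjoint_eigenvector_in_invariant_subspace[OF f] by metis
    then have vv: "v \<bullet> v = 1" by (simp add: dot_square_norm)
    define S' where "S' = {y \<in> S. y \<bullet> v = 0}"
    have sub: "subspace S'" using less.prems(1)
      by (auto simp: S'_def subspace_def inner_simps)
    have "v \<notin> S'" using v(2) by (auto simp: S'_def)
    moreover have "S' \<subseteq> S" by (auto simp: S'_def)
    ultimately have "S' \<subset> S" using v(1) by blast
    then have "dim S' < dim S"
      using sub less.prems(1) by (intro dim_psubset) (simp add: span_eq_iff[THEN iffD2])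
    moreover have "f ` S' \<subseteq> S'" using less.prems(2) v f(2) by (auto simp: S'_def)
    ultimately obtain B where B: "pairwise orthogonal B"
      "\<forall>x\<in>B. norm x = 1 \<and> (\<exists>c. f x = c *\<^sub>R x)" "span B = S'"
      using less.hyps[of S'] sub by blast
    have BS': "B \<subseteq> S'" using B(3) span_superset by blast
    have "pairwise orthogonal (insert v B)"
      using B(1) BS' by (auto simp: pairwise_insert S'_def orthogonal_def inner_commute)
    moreover have "span (insert v B) = S"
    proof
      show "span (insert v B) \<subseteq> S"
        using v BS' less.prems(1) by (intro span_minimal) (auto simp: S'_def)
      show "S \<subseteq> span (insert v B)"
      proof
        fix x assume x: "x \<in> S"
        have "x - (x \<bullet> v) *\<^sub>R v \<in> S'"
          using x v vv less.prems(1) by (simp add: S'_def inner_simps subspace_diff subspace_scale)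
        then have "x - (x \<bullet> v) *\<^sub>R v \<in> span B" using B(3) by simp
        then show "x \<in> span (insert v B)" using span_breakdown_eq by blast
      qed
    qed
    ultimately show ?thesis using B(2) v by (intro exI[of _ "insert v B"]) auto
  qed
qed

definition diag_matrix :: "('m \<Rightarrow> real) \<Rightarrow> real^'m^'m" where
  "diag_matrix c = (\<chi> i j. if i = j then c i else 0)"

lemma diag_matrix_mult_vector: "(diag_matrix c *v x) $ i = c i * x $ i"
  by (simp add: matrix_vector_mult_def diag_matrix_def if_distrib[of "\<lambda>x. x * _"] cong: if_cong)

lemma symmetric_matrix_diagonalization:
  fixes A :: "real^'m^'m"
  assumes "transpose A = A"
  shows "\<exists>Q c. orthogonal_matrix Q \<and> A = Q ** diag_matrix c ** transpose Q"
proof -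
  have "(A *v x) \<bullet> y = x \<bullet> (A *v y)" for x y
    using assms by (metis dot_lmul_matrix transpose_matrix_vector)
  then obtain B where B: "pairwise orthogonal B"
    "\<forall>x\<in>B. norm x = 1 \<and> (\<exists>c. A *v x = c *\<^sub>R x)" "span B = UNIV"
    using selfadjoint_eigenbasis_of_invariant_subspace[of "(*v) A" UNIV] by auto
  have ind: "independent B"
    using B(1,2) by (intro pairwise_orthogonal_independent) auto
  have "card B = CARD('m)"
    using ind B(3) basis_card_eq_dim[of B UNIV] by (simp add: dim_UNIV)
  then obtain b where b: "bij_betw b (UNIV::'m set) B"
    using ind independent_imp_finite finite_same_card_bij[of "UNIV::'m set" B] by auto
  have bB: "b i \<in> B" for i using bij_betw_apply[OF b] by simp
  then have "\<forall>i. \<exists>c. A *v b i = c *\<^sub>R b i" using B(2) by blast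
  then obtain c where c: "\<And>i. A *v b i = c i *\<^sub>R b i" by metis
  define Q :: "real^'m^'m" where "Q = (\<chi> i j. b j $ i)"
  have col: "column j Q = b j" for j by (simp add: Q_def column_def vec_eq_iff)
  have Q: "orthogonal_matrix Q"
    unfolding orthogonal_matrix_orthonormal_columns col
    using B(1,2) bB bij_betw_imp_inj_on[OF b] unfolding pairwise_def inj_on_def by blast
  have "A ** Q = Q ** diag_matrix c"
  proof -
    have "(A ** Q) $ i $ j = (Q ** diag_matrix c) $ i $ j" for i j
    proof -
      have "(A ** Q) $ i $ j = (A *v b j) $ i"
        by (simp add: matrix_matrix_mult_def matrix_vector_mult_def Q_def)
      also have "\<dots> = (Q ** diag_matrix c) $ i $ j"
        unfolding c by (simp add: matrix_matrix_mult_def diag_matrix_def Q_def if_distrib[of "\<lambda>x. _ * x"] cong: if_cong)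
      finally show ?thesis .
    qed
    then show ?thesis by (simp add: vec_eq_iff)
  qed
  then have "A = Q ** diag_matrix c ** transpose Q"
    using Q by (metis matrix_mul_assoc matrix_mul_rid orthogonal_matrix_def orthogonal_matrix)
  with Q show ?thesis by blast
qed

lemma poly_det:
  fixes M :: "real poly^'m^'m"
  shows "poly (det M) x = det (\<chi> i j. poly (M$i$j) x)"
  by (simp add: det_def poly_sum poly_prod)

lemma orthogonal_conjugate_entry:
  "(Q ** diag_matrix c ** transpose Q) $ i $ j = (\<Sum>k\<in>UNIV. c k * (Q$i$k * Q$j$k))"
  by (simp add: matrix_matrix_mult_def diag_matrix_def transpose_def if_distrib[of "\<lambda>x. _ * x"]
      algebra_simps cong: if_cong)

lemma orthogonal_rows_sum:
  fixes Q :: "real^'m^'m"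
  assumes "orthogonal_matrix Q"
  shows "(\<Sum>k\<in>UNIV. Q$i$k * Q$j$k) = (if i = j then 1 else 0)"
proof -
  have "(Q ** transpose Q) $ i $ j = mat 1 $ i $ j" using assms by (simp add: orthogonal_matrix_def)
  then show ?thesis by (simp add: matrix_matrix_mult_def transpose_def mat_def)
qed

text \<open>Written out, \<open>Q diag(c) Q\<^sup>T\<close> is the sum of the rank-one matrices \<open>c\<^sub>k v\<^sub>k v\<^sub>k\<^sup>T\<close> over the columns
  \<open>v\<^sub>k\<close> of \<open>Q\<close>.\<close>

lemma orthogonal_conjugate_inner:
  "(Q ** diag_matrix c ** transpose Q) \<bullet> Z
     = (\<Sum>k\<in>UNIV. c k * (column k Q \<bullet> (Z *v column k Q)))"
proof -
  have "(Q ** diag_matrix c ** transpose Q) \<bullet> Z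
      = (\<Sum>i\<in>UNIV. \<Sum>j\<in>UNIV. \<Sum>k\<in>UNIV. c k * (Q$i$k * (Z$i$j * Q$j$k)))"
    by (simp add: inner_vec_def orthogonal_conjugate_entry sum_distrib_left sum_distrib_right mult_ac)
  also have "\<dots> = (\<Sum>i\<in>UNIV. \<Sum>k\<in>UNIV. \<Sum>j\<in>UNIV. c k * (Q$i$k * (Z$i$j * Q$j$k)))"
    by (intro sum.cong refl sum.swap)
  also have "\<dots> = (\<Sum>k\<in>UNIV. \<Sum>i\<in>UNIV. \<Sum>j\<in>UNIV. c k * (Q$i$k * (Z$i$j * Q$j$k)))"
    by (rule sum.swap)
  also have "\<dots> = (\<Sum>k\<in>UNIV. c k * (column k Q \<bullet> (Z *v column k Q)))"
    by (simp add: inner_vec_def column_def matrix_vector_mult_def sum_distrib_left)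
  finally show ?thesis .
qed

lemma orthogonal_conjugate_mult_column:
  fixes Q :: "real^'m^'m"
  assumes "orthogonal_matrix Q"
  shows "(Q ** diag_matrix c ** transpose Q) *v column k Q = c k *\<^sub>R column k Q"
proof -
  have col: "column k Q = Q *v axis k 1" by (simp add: matrix_vector_mult_basis)
  have "diag_matrix c *v axis k 1 = c k *\<^sub>R axis k 1"
    unfolding matrix_vector_mult_basis by (auto simp: vec_eq_iff column_def diag_matrix_def axis_def)
  moreover have "transpose Q *v (Q *v axis k 1) = axis k 1"
    using assms by (simp add: matrix_vector_mul_assoc orthogonal_matrix)
  ultimately show ?thesis
    unfolding col by (simp add: matrix_vector_mult_scaleR flip: matrix_vector_mul_assoc)
qed

text \<open>The eigenvalues in question are roots of a determinant of polynomial matrices. Comparing that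
  determinant with the product of the linear factors at every real argument moves the
  computation to real matrices, where conjugation by \<open>Q\<close> cancels.\<close>

lemma eigenvalues_orthogonal_conjugate:
  fixes Q :: "real^'m^'m"
  assumes Q: "orthogonal_matrix Q" 
  shows "eigenvalues (Q ** diag_matrix c ** transpose Q) = image_mset c (mset_set UNIV)"
proof -
  let ?A = "Q ** diag_matrix c ** transpose Q"
  let ?C = "\<chi> i j. if i = j then [:- ?A$i$j, 1:] else [:- ?A$i$j:]"
  have "det ?C = (\<Prod>i\<in>UNIV. [:- c i, 1:])"
  proof (rule poly_eq_poly_eq_iff[THEN iffD1], rule ext)
    fix x
    have "poly (det ?C) x = det (Q ** diag_matrix (\<lambda>i. x - c i) ** transpose Q)"
    proof -
      have "poly (?C $ i $ j) x = (Q ** diag_matrix (\<lambda>i. x - c i) ** transpose Q) $ i $ j" for i j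
      proof -
        have "(Q ** diag_matrix (\<lambda>i. x - c i) ** transpose Q) $ i $ j
            = x * (\<Sum>k\<in>UNIV. Q$i$k * Q$j$k) - ?A $ i $ j"
          by (simp add: orthogonal_conjugate_entry sum_distrib_left sum_subtractf left_diff_distrib)
        then show ?thesis by (simp add: orthogonal_rows_sum[OF Q])
      qed
      then have "(\<chi> i j. poly (?C $ i $ j) x) = Q ** diag_matrix (\<lambda>i. x - c i) ** transpose Q"
        unfolding vec_eq_iff by simp
      then show ?thesis unfolding poly_det by (rule arg_cong)
    qed
    also have "\<dots> = det (diag_matrix (\<lambda>i. x - c i)) * det (Q ** transpose Q)"
      by (simp add: det_mul)
    also have "\<dots> = det (diag_matrix (\<lambda>i. x - c i) :: real^'m^'m)"
      using Q by (simp add: orthogonal_matrix_def)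
    also have "\<dots> = (\<Prod>i\<in>UNIV. x - c i)"
      by (subst det_diagonal) (simp_all add: diag_matrix_def)
    also have "\<dots> = poly (\<Prod>i\<in>UNIV. [:- c i, 1:]) x" by (simp add: poly_prod)
    finally show "poly (det ?C) x = poly (\<Prod>i\<in>UNIV. [:- c i, 1:]) x" .
  qed
  then have "eigenvalues ?A = (\<Sum>i\<in>UNIV. {#c i#})"
    by (simp add: eigenvalues_def proots_prod)
  also have "\<dots> = image_mset c (mset_set UNIV)"
    by (simp add: sum_unfold_sum_mset)
  finally show ?thesis .
qed

section \<open>Differentiability of the split energies\<close>

text \<open>Comparing with the old closest point bounds the squared distance at \<open>x + h\<close> from above by its
  linearization at \<open>x\<close> plus \<open>|h|\<^sup>2\<close>. Exchanging the roles of \<open>x\<close> and \<open>x + h\<close> gives the bound from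
  below, up to a change of the gradient that is controlled because the projection is
  nonexpansive.\<close>

lemma has_derivative_sq_dist_closest_point:
  fixes C :: "'a::euclidean_space set"
  assumes C: "closed C" "convex C" "C \<noteq> {}"
  shows "((\<lambda>x. (dist x (closest_point C x))\<^sup>2) has_derivative
     (\<lambda>h. 2 * ((x - closest_point C x) \<bullet> h))) (at x)"
proof -
  let ?P = "closest_point C"
  let ?f = "\<lambda>x. (dist x (?P x))\<^sup>2"
  have in_C: "?P y \<in> C" for y using C by (simp add: closest_point_in_set)
  have step: "?f (y + h) \<le> ?f y + 2 * ((y - ?P y) \<bullet> h) + (norm h)\<^sup>2" for y h
  proof -
    have "?f (y + h) \<le> (dist (y + h) (?P y))\<^sup>2"
      using C in_C by (intro power_mono closest_point_le) auto
    also have "\<dots> = ?f y + 2 * ((y - ?P y) \<bullet> h) + (norm h)\<^sup>2"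
      by (simp add: dist_norm power2_norm_eq_inner inner_simps inner_commute)
    finally show ?thesis .
  qed
  have "\<bar>?f (x + h) - ?f x - 2 * ((x - ?P x) \<bullet> h)\<bar> \<le> (norm h)\<^sup>2" for h
  proof -
    have "(?P (x + h) - ?P x) \<bullet> h \<le> norm (?P (x + h) - ?P x) * norm h"
      by (rule norm_cauchy_schwarz)
    also have "\<dots> \<le> norm h * norm h"
      using closest_point_lipschitz[OF C(2,1,3), of "x + h" x]
      by (intro mult_right_mono) (simp_all add: dist_norm)
    finally have "(?P (x + h) - ?P x) \<bullet> h \<le> (norm h)\<^sup>2" by (simp add: power2_eq_square)
    moreover have "?f x \<le> ?f (x + h) - 2 * ((x + h - ?P (x + h)) \<bullet> h) + (norm h)\<^sup>2"
      using step[of "x + h" "- h"] by simp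
    ultimately have "?f (x + h) - ?f x - 2 * ((x - ?P x) \<bullet> h) \<ge> - (norm h)\<^sup>2"
      by (simp add: inner_simps power2_norm_eq_inner)
    moreover have "?f (x + h) - ?f x - 2 * ((x - ?P x) \<bullet> h) \<le> (norm h)\<^sup>2"
      using step[of x h] by simp
    ultimately show ?thesis by linarith
  qed
  then have bound: "\<bar>?f y - ?f x - 2 * ((x - ?P x) \<bullet> (y - x))\<bar> \<le> norm (y - x) * norm (y - x)" for y
    by (metis add.commute diff_add_cancel power2_eq_square)
  show ?thesis unfolding has_derivative_at_alt
  proof (intro conjI allI impI)
    show "bounded_linear (\<lambda>h. 2 * ((x - ?P x) \<bullet> h))"
      by (intro bounded_linear_intros)
    fix e :: real assume "e > 0"
    then show "\<exists>d>0. \<forall>y. norm (y - x) < d \<longrightarrow>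
        norm (?f y - ?f x - 2 * ((x - ?P x) \<bullet> (y - x))) \<le> e * norm (y - x)"
      using bound by (intro exI[of _ e]) (auto intro!: order.trans[OF bound] mult_right_mono)
  qed
qed

text \<open>The members need not be symmetric; the one closest to a symmetric matrix is symmetric
  nevertheless.\<close>

definition negative_semidefinite :: "(real^'m^'m) set" where
  "negative_semidefinite = {Z. \<forall>x. x \<bullet> (Z *v x) \<le> 0}"

lemma linear_quadratic_form: "linear (\<lambda>Z::real^'m^'m. x \<bullet> (Z *v x))"
  by (rule linearI) (simp_all add: inner_simps algebra_simps flip: scaleR_matrix_vector_assoc)

lemma negative_semidefinite_cone:
  "closed (negative_semidefinite :: (real^'m^'m) set)"
  "convex (negative_semidefinite :: (real^'m^'m) set)"
  "(negative_semidefinite :: (real^'m^'m) set) \<noteq> {}"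
proof -
  have eq: "(negative_semidefinite :: (real^'m^'m) set) = (\<Inter>x. (\<lambda>Z. x \<bullet> (Z *v x)) -` {..0})"
    by (auto simp: negative_semidefinite_def)
  show "closed (negative_semidefinite :: (real^'m^'m) set)"
    unfolding eq using linear_quadratic_form
    by (intro closed_INT ballI continuous_closed_vimage closed_atMost linear_continuous_at)
       (auto simp: linear_linear)
  show "convex (negative_semidefinite :: (real^'m^'m) set)"
    unfolding eq by (intro convex_INT convex_linear_vimage linear_quadratic_form) auto
  have "0 \<in> (negative_semidefinite :: (real^'m^'m) set)"
    by (simp add: negative_semidefinite_def)
  then show "(negative_semidefinite :: (real^'m^'m) set) \<noteq> {}" by blast
qed

text \<open>Clipping the eigenvalues of \<open>A\<close> at 0 from above gives the closest negative semidefinite matrix: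
  the remainder is positive semidefinite, hence has nonpositive inner product with the whole
  cone, and it is orthogonal to the clipped matrix.\<close>

lemma symmetric_matrix_eigenvalue_sums:
  fixes A :: "real^'m^'m"
  assumes "transpose A = A"
  shows "sum_mset (eigenvalues A) = trace A"
    and "(\<Sum>x\<in>#eigenvalues A. (pos_part x)\<^sup>2)
       = (dist A (closest_point negative_semidefinite A))\<^sup>2"
    and "(\<Sum>x\<in>#eigenvalues A. (neg_part x)\<^sup>2)
       = A \<bullet> A - (dist A (closest_point negative_semidefinite A))\<^sup>2"
proof -
  obtain Q c where Q: "orthogonal_matrix Q" and A: "A = Q ** diag_matrix c ** transpose Q"
    using symmetric_matrix_diagonalization[OF assms] by blast
  define M where "M a = Q ** diag_matrix a ** transpose Q" for a
  have A: "A = M c" by (simp add: A M_def)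
  have unit: "column k Q \<bullet> column k Q = 1" for k
    using Q by (simp add: orthogonal_matrix_orthonormal_columns dot_square_norm)
  have inner: "M a \<bullet> M b = (\<Sum>k\<in>UNIV. a k * b k)" for a b
    unfolding M_def orthogonal_conjugate_inner by (simp add: orthogonal_conjugate_mult_column[OF Q] unit)
  have eig: "(\<Sum>x\<in>#eigenvalues A. f x) = (\<Sum>k\<in>UNIV. f (c k))" for f :: "real \<Rightarrow> real"
    by (simp add: A M_def eigenvalues_orthogonal_conjugate[OF Q] image_mset.compositionality o_def
      sum_unfold_sum_mset)
  have "trace A = M c \<bullet> mat 1"
    by (simp add: A trace_def inner_vec_def mat_def if_distrib[of "\<lambda>x. _ * x"] cong: if_cong)
  also have "\<dots> = (\<Sum>k\<in>UNIV. c k)"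
    unfolding M_def orthogonal_conjugate_inner by (simp add: unit)
  finally show "sum_mset (eigenvalues A) = trace A"
    using eig[of "\<lambda>x. x"] by simp
  let ?p = "\<lambda>k. pos_part (c k)" and ?n = "\<lambda>k. neg_part (c k)"
  have split: "M c - M ?n = M ?p"
    by (simp add: M_def vec_eq_iff orthogonal_conjugate_entry flip: sum_subtractf left_diff_distrib)
      (auto simp: pos_part_def neg_part_def intro!: sum.cong)
  have n: "M ?n \<in> negative_semidefinite"
  proof -
    have "x \<bullet> (M ?n *v x) \<le> 0" for x
    proof -
      have "x \<bullet> (M ?n *v x) = (transpose Q *v x) \<bullet> (diag_matrix ?n *v (transpose Q *v x))"
        unfolding M_def by (metis dot_lmul_matrix matrix_vector_mul_assoc transpose_transpose transpose_matrix_vector)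
      also have "\<dots> = (\<Sum>k\<in>UNIV. ?n k * ((transpose Q *v x) $ k)\<^sup>2)"
        by (simp add: inner_vec_def diag_matrix_mult_vector power2_eq_square mult_ac)
      also have "\<dots> \<le> 0"
        by (intro sum_nonpos mult_nonpos_nonneg) (auto simp: neg_part_def)
      finally show ?thesis .
    qed
    then show ?thesis by (simp add: negative_semidefinite_def)
  qed
  have "dist (M c) (M ?n) \<le> dist (M c) Z" if Z: "Z \<in> negative_semidefinite" for Z
  proof -
    have "M ?p \<bullet> Z \<le> 0"
      unfolding M_def orthogonal_conjugate_inner using Z
      by (intro sum_nonpos mult_nonneg_nonpos) (auto simp: pos_part_def negative_semidefinite_def)
    moreover have "M ?p \<bullet> M ?n = 0"
      unfolding inner by (auto intro!: sum.neutral simp: pos_part_def neg_part_def max_def min_def)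
    ultimately have "M ?p \<bullet> (M ?n - Z) \<ge> 0" by (simp add: inner_diff_right)
    moreover have "(norm (M c - Z))\<^sup>2 = (norm (M ?p + (M ?n - Z)))\<^sup>2"
      using split by (simp add: algebra_simps)
    ultimately have "(norm (M c - M ?n))\<^sup>2 \<le> (norm (M c - Z))\<^sup>2"
      unfolding split by (simp add: power2_norm_eq_inner inner_add_left inner_add_right inner_commute)
    then show ?thesis by (simp add: dist_norm)
  qed
  then have "M ?n = closest_point negative_semidefinite A"
    unfolding A using negative_semidefinite_cone n by (intro closest_point_unique) auto
  then have "(dist A (closest_point negative_semidefinite A))\<^sup>2 = M ?p \<bullet> M ?p"
    using split A by (metis dist_norm power2_norm_eq_inner)
  also have "\<dots> = (\<Sum>k\<in>UNIV. (?p k)\<^sup>2)" by (simp add: inner power2_eq_square)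
  finally have d: "(dist A (closest_point negative_semidefinite A))\<^sup>2 = (\<Sum>k\<in>UNIV. (?p k)\<^sup>2)" .
  then show "(\<Sum>x\<in>#eigenvalues A. (pos_part x)\<^sup>2)
       = (dist A (closest_point negative_semidefinite A))\<^sup>2" by (simp add: eig)
  have "A \<bullet> A = (\<Sum>k\<in>UNIV. (?p k)\<^sup>2 + (?n k)\<^sup>2)"
    unfolding A inner by (auto intro!: sum.cong simp: pos_part_def neg_part_def max_def min_def power2_eq_square)
  then show "(\<Sum>x\<in>#eigenvalues A. (neg_part x)\<^sup>2)
       = A \<bullet> A - (dist A (closest_point negative_semidefinite A))\<^sup>2"
    by (simp add: d eig sum.distrib)
qed

text \<open>The scalar case of the same principle: \<open>(pos_part x)\<^sup>2\<close> is the squared distance of \<open>x\<close> to the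
  half-line of nonpositive numbers.\<close>

lemma pos_part_square_differentiable: "(\<lambda>x. (pos_part x)\<^sup>2) differentiable (at x)"
proof -
  have eq: "(\<lambda>x::real. (pos_part x)\<^sup>2) = (\<lambda>x. (dist x (closest_point {..0} x))\<^sup>2)"
  proof
    fix x :: real
    have "closest_point {..0} x = neg_part x"
      by (rule closest_point_unique[symmetric]) (auto simp: neg_part_def dist_real_def)
    then show "(pos_part x)\<^sup>2 = (dist x (closest_point {..0} x))\<^sup>2"
      by (auto simp: pos_part_def neg_part_def dist_real_def max_def min_def)
  qed
  have "((\<lambda>x::real. (dist x (closest_point {..0} x))\<^sup>2) has_derivative
     (\<lambda>h. 2 * ((x - closest_point {..0} x) \<bullet> h))) (at x)"
    by (rule has_derivative_sq_dist_closest_point) auto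
  then show ?thesis unfolding eq differentiable_def by blast
qed

lemma neg_part_square_differentiable: "(\<lambda>x. (neg_part x)\<^sup>2) differentiable (at x)"
proof -
  have "(\<lambda>x. (neg_part x)\<^sup>2) = (\<lambda>x. (pos_part (- x))\<^sup>2)"
    by (auto simp: fun_eq_iff neg_part_def pos_part_def max_def min_def)
  moreover have "(\<lambda>x. (pos_part (- x))\<^sup>2) differentiable (at x)"
    by (rule differentiable_compose[of "\<lambda>x. (pos_part x)\<^sup>2"])
      (auto intro: pos_part_square_differentiable)
  ultimately show ?thesis by simp
qed

lemma linear_trace: "linear (trace :: real^'m^'m \<Rightarrow> real)"
  by (rule linearI) (simp_all add: trace_def sum.distrib sum_distrib_left)

lemma trace_differentiable: "(trace :: real^'m^'m \<Rightarrow> real) differentiable (at A)"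
  by (rule linear_imp_differentiable[OF linear_trace])

lemma differentiable_inner':
  fixes f g :: "'a::real_normed_vector \<Rightarrow> 'b::real_inner"
  assumes "f differentiable (at x)" "g differentiable (at x)"
  shows "(\<lambda>x. f x \<bullet> g x) differentiable (at x)"
  using assms unfolding differentiable_def by (blast intro: has_derivative_inner)

text \<open>Strains are symmetric, so only symmetric arguments matter. Replacing the energies by functions
  that are differentiable on all matrices makes the ordinary chain rule applicable.\<close>

lemma split_energies_differentiable_extension:
  fixes sp :: energy_split and lam mu :: real
  shows "\<exists>P N :: real^'m^'m \<Rightarrow> real. (\<forall>A. P differentiable (at A) \<and> N differentiable (at A)) \<and>
     (\<forall>A. transpose A = A \<longrightarrow> psi0_plus sp lam mu A = P A \<and> psi0_minus sp lam mu A = N A)"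
proof -
  let ?D = "\<lambda>A::real^'m^'m. (dist A (closest_point negative_semidefinite A))\<^sup>2"
  let ?tr = "trace :: real^'m^'m \<Rightarrow> real"
  have D: "?D differentiable (at A)" for A
    using has_derivative_sq_dist_closest_point[OF negative_semidefinite_cone]
    unfolding differentiable_def by blast
  have I: "(\<lambda>A::real^'m^'m. A \<bullet> A) differentiable (at A)" for A
    by (intro differentiable_inner' differentiable_ident)
  have dev: "(\<lambda>A::real^'m^'m. dev A) differentiable (at A)" for A
    unfolding dev_def
    by (intro linear_imp_differentiable linear_compose_sub linear_id[unfolded id_def])
       (auto intro!: linearI simp: linear_add[OF linear_trace] linear_scale[OF linear_trace] add_divide_distrib scaleR_add_left)
  have dd: "(\<lambda>A::real^'m^'m. dev A \<bullet> dev A) differentiable (at A)" for A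
    by (intro differentiable_inner' dev)
  have p: "(\<lambda>A. (pos_part (?tr A))\<^sup>2) differentiable (at A)" for A
    by (rule differentiable_compose[of "\<lambda>x. (pos_part x)\<^sup>2" trace])
      (auto intro: pos_part_square_differentiable trace_differentiable)
  have n: "(\<lambda>A. (neg_part (?tr A))\<^sup>2) differentiable (at A)" for A
    by (rule differentiable_compose[of "\<lambda>x. (neg_part x)\<^sup>2" trace])
      (auto intro: neg_part_square_differentiable trace_differentiable)
  note diff = D I dd p n trace_differentiable
  have AA: "trace (A ** A) = A \<bullet> A" if "transpose A = A" for A :: "real^'m^'m"
  proof -
    have "A $ j $ i = A $ i $ j" for i j using that by (metis transpose_def vec_lambda_beta)
    then show ?thesis by (simp add: trace_def matrix_matrix_mult_def inner_vec_def)
  qed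
  have result: ?thesis
    if "\<And>A. P differentiable (at A)" "\<And>A. N differentiable (at A)"
      "\<And>A. transpose A = A \<Longrightarrow> psi0_plus sp lam mu A = P A"
      "\<And>A. transpose A = A \<Longrightarrow> psi0_minus sp lam mu A = N A"
    for P N :: "real^'m^'m \<Rightarrow> real"
    using that by blast
  show ?thesis
  proof (cases sp)
    case No_Split
    then show ?thesis
      by (intro result[of "\<lambda>A::real^'m^'m. lam / 2 * (trace A)\<^sup>2 + mu * (A \<bullet> A)"
          "\<lambda>A::real^'m^'m. 0::real"])
         (auto simp: psi0_def AA intro!: derivative_intros diff)
  next
    case Vol_Dev
    then show ?thesis
      by (intro result[of "\<lambda>A::real^'m^'m. (mu / real CARD('m) + lam / 2) * (trace A)\<^sup>2"
          "\<lambda>A::real^'m^'m. mu * (dev A \<bullet> dev A)"])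
         (auto intro!: derivative_intros diff)
  next
    case Vol_Dev_Unilateral
    then show ?thesis
      by (intro result[of "\<lambda>A::real^'m^'m. (mu / real CARD('m) + lam / 2) * (pos_part (trace A))\<^sup>2"
          "\<lambda>A::real^'m^'m. (mu / real CARD('m) + lam / 2) * (neg_part (trace A))\<^sup>2
                   + mu * (dev A \<bullet> dev A)"])
         (auto intro!: derivative_intros diff)
  next
    case Spectral
    then show ?thesis
      by (intro result[of "\<lambda>A::real^'m^'m. lam / 2 * (pos_part (trace A))\<^sup>2 + mu * ?D A"
          "\<lambda>A::real^'m^'m. lam / 2 * (neg_part (trace A))\<^sup>2 + mu * (A \<bullet> A - ?D A)"])
         (auto simp: symmetric_matrix_eigenvalue_sums intro!: derivative_intros diff)
  qed
qed

section \<open>Shape functions and reference elements\<close>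

text \<open>Continuity of the gradient is what makes the gradient of a finite element function bounded and
  measurable on each element.\<close>

definition C1_function :: "('a::euclidean_space \<Rightarrow> real) \<Rightarrow> bool" where
  "C1_function v \<longleftrightarrow> (\<exists>G. continuous_on UNIV G \<and> (\<forall>x. (v has_derivative (\<lambda>h. G x \<bullet> h)) (at x)))"

lemma C1_function_continuous_on: "C1_function v \<Longrightarrow> continuous_on S v"
  unfolding C1_function_def
  by (meson continuous_at_imp_continuous_on has_derivative_continuous)

lemma C1_function_const: "C1_function (\<lambda>_. c)"
proof -
  have "(\<bullet>) (0::'a) = (\<lambda>_. 0)" by (simp add: fun_eq_iff)
  then show ?thesis unfolding C1_function_def by (intro exI[of _ "\<lambda>_. 0"]) auto
qed

lemma C1_function_inner: "C1_function (\<lambda>x. a \<bullet> x)"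
  unfolding C1_function_def
  by (intro exI[of _ "\<lambda>_. a"]) (auto intro!: derivative_eq_intros)

lemma C1_function_nth: "C1_function (\<lambda>x::real^'m. x $ i)"
  using C1_function_inner[of "axis i 1 :: real^'m"] by (simp add: inner_axis' inner_real_def)

lemma C1_function_add:
  assumes "C1_function v" "C1_function w" shows "C1_function (\<lambda>x. v x + w x)"
proof -
  obtain G H where "continuous_on UNIV G" "\<And>x. (v has_derivative (\<lambda>h. G x \<bullet> h)) (at x)"
    "continuous_on UNIV H" "\<And>x. (w has_derivative (\<lambda>h. H x \<bullet> h)) (at x)"
    using assms unfolding C1_function_def by blast
  then show ?thesis unfolding C1_function_def
    by (intro exI[of _ "\<lambda>x. G x + H x"])
       (auto intro!: continuous_intros derivative_eq_intros simp: inner_add_left)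
qed

lemma C1_function_mult:
  assumes "C1_function v" "C1_function w" shows "C1_function (\<lambda>x. v x * w x)"
proof -
  obtain G H where "continuous_on UNIV G" "\<And>x. (v has_derivative (\<lambda>h. G x \<bullet> h)) (at x)"
    "continuous_on UNIV H" "\<And>x. (w has_derivative (\<lambda>h. H x \<bullet> h)) (at x)"
    using assms unfolding C1_function_def by blast
  then show ?thesis unfolding C1_function_def
    using assms[THEN C1_function_continuous_on]
    by (intro exI[of _ "\<lambda>x. v x *\<^sub>R H x + w x *\<^sub>R G x"])
       (auto intro!: continuous_intros derivative_eq_intros simp: inner_add_left)
qed

lemma C1_function_sum: "(\<And>i. i \<in> I \<Longrightarrow> C1_function (f i)) \<Longrightarrow> C1_function (\<lambda>x. \<Sum>i\<in>I. f i x)"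
  by (induction I rule: infinite_finite_induct) (auto intro: C1_function_const C1_function_add)

lemma C1_function_prod: "(\<And>i. i \<in> I \<Longrightarrow> C1_function (f i)) \<Longrightarrow> C1_function (\<lambda>x. \<Prod>i\<in>I. f i x)"
  by (induction I rule: infinite_finite_induct) (auto intro: C1_function_const C1_function_mult)

lemma shape_function_C1: 
  assumes "shape_function s v" shows "C1_function v"
proof (cases s)
  case Simplex
  with assms obtain a b where "v = (\<lambda>x. a \<bullet> x + b)" by auto
  then show ?thesis by (auto intro: C1_function_add C1_function_inner C1_function_const)
next
  case Cube
  with assms obtain c where "v = (\<lambda>x. \<Sum>S\<in>UNIV. c S * (\<Prod>i\<in>S. x$i))" by auto
  then show ?thesis
    by (auto intro!: C1_function_sum C1_function_prod C1_function_mult C1_function_const C1_function_nth)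
qed

lemma shape_function_lincomb:
  assumes "\<And>i. i \<in> I \<Longrightarrow> shape_function s (w i)"
  shows "shape_function s (\<lambda>x. \<Sum>i\<in>I. w i x * r i)"
proof (cases s)
  case Simplex
  then have "\<forall>i\<in>I. \<exists>a b. \<forall>x. w i x = a \<bullet> x + b" using assms by simp
  then obtain a b where ab: "\<And>i x. i \<in> I \<Longrightarrow> w i x = a i \<bullet> x + b i" by metis
  have "\<forall>x. (\<Sum>i\<in>I. w i x * r i) = (\<Sum>i\<in>I. r i *\<^sub>R a i) \<bullet> x + (\<Sum>i\<in>I. b i * r i)"
    by (simp add: ab inner_sum_left sum.distrib[symmetric] algebra_simps)
  then show ?thesis using Simplex by auto
next
  case Cube
  then have "\<forall>i\<in>I. \<exists>c. \<forall>x. w i x = (\<Sum>S\<in>UNIV. c S * (\<Prod>i\<in>S. x$i))" using assms by simp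
  then obtain c where c: "\<And>i x. i \<in> I \<Longrightarrow> w i x = (\<Sum>S\<in>UNIV. c i S * (\<Prod>i\<in>S. x$i))" by metis
  have "(\<Sum>i\<in>I. w i x * r i) = (\<Sum>S\<in>UNIV. (\<Sum>i\<in>I. c i S * r i) * (\<Prod>i\<in>S. x$i))" for x
  proof -
    have "(\<Sum>i\<in>I. w i x * r i) = (\<Sum>i\<in>I. \<Sum>S\<in>UNIV. c i S * r i * (\<Prod>i\<in>S. x$i))"
      by (simp add: c sum_distrib_right sum_distrib_left mult_ac)
    also have "\<dots> = (\<Sum>S\<in>UNIV. \<Sum>i\<in>I. c i S * r i * (\<Prod>i\<in>S. x$i))" by (rule sum.swap)
    finally show ?thesis by (simp add: sum_distrib_right)
  qed
  then show ?thesis using Cube by auto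
qed

lemma multiaffine_segment:
  fixes x :: "real^'m"
  assumes w: "\<And>x::real^'m. w x = (\<Sum>S\<in>UNIV. c S * (\<Prod>i\<in>S. x$i))"
  shows "w x = (1 - x$i) * w (\<chi> j. if j = i then 0 else x$j) + x$i * w (\<chi> j. if j = i then 1 else x$j)"
proof -
  have "(\<Prod>j\<in>S. x$j) = (1 - x$i) * (\<Prod>j\<in>S. if j = i then 0 else x$j)
      + x$i * (\<Prod>j\<in>S. if j = i then 1 else x$j)" for S
  proof (cases "i \<in> S")
    case True
    then have "(\<Prod>j\<in>S. f j) = f i * (\<Prod>j\<in>S - {i}. f j)" for f :: "'m \<Rightarrow> real"
      by (simp add: prod.remove)
    then show ?thesis by simp
  next
    case False
    then have "(\<Prod>j\<in>S. if j = i then a else x$j) = (\<Prod>j\<in>S. x$j)" for a :: real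
      by (intro prod.cong) auto
    then show ?thesis by (simp add: algebra_simps)
  qed
  then have "c S * (\<Prod>j\<in>S. x$j) = (1 - x$i) * (c S * (\<Prod>j\<in>S. if j = i then 0 else x$j))
      + x$i * (c S * (\<Prod>j\<in>S. if j = i then 1 else x$j))" for S
    by (metis (no_types, lifting) distrib_left mult.left_commute)
  then show ?thesis
    by (simp add: w sum_distrib_left sum.distrib)
qed

lemma cube_subset: "(ref_element Cube :: (real^'m) set) \<subseteq> {x. \<forall>i. x$i \<in> {0..1}}"
proof -
  have "convex {x::real^'m. \<forall>i. x$i \<in> {0..1}}"
    by (auto simp: convex_def intro!: convex_bound_le add_nonneg_nonneg)
  then show ?thesis unfolding ref_element_def by (intro hull_minimal) (auto, (metis order.refl zero_le_one)+)
qed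

text \<open>On the simplex an affine function maps convex combinations to convex combinations. On the cube
  a multi-affine function is affine in each single coordinate, so its value is a convex
  combination of two values at points with one more coordinate in \<open>{0, 1}\<close>; iterating this ends
  at the vertices.\<close>

lemma shape_function_in_convex:
  fixes v :: "real^'m \<Rightarrow> real"
  assumes v: "shape_function s v" and C: "convex C"
    and vert: "\<And>x. x \<in> ref_vertices s \<Longrightarrow> v x \<in> C" and x: "x \<in> ref_element s"
  shows "v x \<in> C"
proof (cases s)
  case Simplex
  with v obtain a b where ab: "\<And>x. v x = a \<bullet> x + b" by auto
  have "v (r *\<^sub>R x + t *\<^sub>R y) = r *\<^sub>R v x + t *\<^sub>R v y" if "r + t = 1" for x y r t
  proof -
    have t: "t = 1 - r" using that by simp
    show ?thesis unfolding ab t by (simp add: inner_simps algebra_simps)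
  qed
  then have "convex (v -` C)" using C by (auto simp: convex_def)
  then show ?thesis
    using x vert hull_minimal[of "ref_vertices s" "v -` C" convex] by (auto simp: ref_element_def)
next
  case Cube
  with v obtain c where c: "\<And>x. v x = (\<Sum>S\<in>UNIV. c S * (\<Prod>i\<in>S. x$i))" by auto
  have "\<forall>i. x$i \<in> {0..1}" using cube_subset x Cube by auto
  then show ?thesis
  proof (induction "card {i. x$i \<notin> {0, 1}}" arbitrary: x rule: less_induct)
    case less
    show ?case
    proof (cases "\<forall>i. x$i \<in> {0, 1}")
      case True
      then show ?thesis using vert Cube by simp
    next
      case False
      then obtain i where i: "x$i \<notin> {0, 1}" by blast
      have "v (\<chi> j. if j = i then a else x$j) \<in> C" if a: "a \<in> {0, 1}" for a
      proof (rule less.hyps)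
        have "{j. (\<chi> j. if j = i then a else x$j) $ j \<notin> {0, 1}} \<subset> {j. x$j \<notin> {0, 1}}"
          using a i by auto
        then show "card {j. (\<chi> j. if j = i then a else x$j) $ j \<notin> {0, 1}} < card {j. x$j \<notin> {0, 1}}"
          by (intro psubset_card_mono) auto
        show "\<forall>j. (\<chi> j. if j = i then a else x$j) $ j \<in> {0..1}" using a less.prems by auto
      qed
      then have "(1 - x$i) *\<^sub>R v (\<chi> j. if j = i then 0 else x$j) + (x$i) *\<^sub>R v (\<chi> j. if j = i then 1 else x$j) \<in> C"
        using less.prems[rule_format, of i] C by (intro convexD) auto
      then show ?thesis using multiaffine_segment[of v c x i, OF c] by simp
    qed
  qed
qed

text \<open>Both reference elements contain the standard simplex, which supplies the interior point.\<close>

lemma ref_element_convex_body: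
  fixes s :: ref_shape
  shows "compact (ref_element s :: (real^'m) set)" "convex (ref_element s :: (real^'m) set)"
    "interior (ref_element s :: (real^'m) set) \<noteq> {}"
proof -
  have "finite (ref_vertices s :: (real^'m) set)"
  proof (cases s)
    case Cube
    have "(ref_vertices Cube :: (real^'m) set) \<subseteq> range (\<lambda>S. \<chi> i. if i \<in> S then 1 else 0)"
    proof
      fix x :: "real^'m" assume "x \<in> ref_vertices Cube"
      then have "x = (\<chi> i. if i \<in> {i. x$i = 1} then 1 else 0)" by (auto simp: vec_eq_iff)
      then show "x \<in> range (\<lambda>S. \<chi> i. if i \<in> S then 1 else 0)" by blast
    qed
    then show ?thesis unfolding Cube by (rule finite_subset) simp
  qed simp
  then show "compact (ref_element s :: (real^'m) set)"
    by (simp add: ref_element_def finite_imp_compact_convex_hull)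
  show "convex (ref_element s :: (real^'m) set)" by (simp add: ref_element_def)
  have "insert 0 Basis \<subseteq> (ref_vertices s :: (real^'m) set)"
    by (cases s) (auto simp: Basis_vec_def axis_def)
  then have "convex hull (insert 0 Basis) \<subseteq> (ref_element s :: (real^'m) set)"
    unfolding ref_element_def by (rule hull_mono)
  moreover obtain a :: "real^'m" where "a \<in> interior (convex hull (insert 0 Basis))"
    using interior_std_simplex_nonempty .
  ultimately show "interior (ref_element s :: (real^'m) set) \<noteq> {}"
    using interior_mono by blast
qed

section \<open>Finite element functions on one element\<close>

text \<open>Near \<open>x\<close> the map \<open>F\<close> expands distances at least by a fixed factor, since \<open>F'\<close> is injective, and
  points of \<open>F ` R\<close> near \<open>F x\<close> come from points near \<open>x\<close>, since \<open>R\<close> is compact. So an error that is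
  small compared with \<open>y - x\<close> is small compared with \<open>F y - F x\<close>. No neighbourhood of \<open>F x\<close> is
  involved, so boundary points of the image are covered.\<close>

lemma has_derivative_on_parametrized_set:
  fixes F :: "'a::euclidean_space \<Rightarrow> 'b::euclidean_space" and v :: "'b \<Rightarrow> 'c::real_normed_vector"
  assumes R: "compact R" "x \<in> R" and F: "continuous_on R F" "inj_on F R"
    and F': "(F has_derivative F') (at x within R)" "inj F'"
    and w: "(w has_derivative (\<lambda>h. v' (F' h))) (at x within R)"
    and v': "bounded_linear v'" and v: "\<And>y. y \<in> R \<Longrightarrow> v (F y) = w y"
  shows "(v has_derivative v') (at (F x) within F ` R)"
proof -
  interpret v': bounded_linear v' by (rule v')
  interpret F': bounded_linear F' using F'(1) by (rule has_derivative_bounded_linear)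
  obtain c where c: "c > 0" "\<And>h. c * norm h \<le> norm (F' h)"
    using linear_inj_bounded_below_pos[OF F'.linear F'(2)] by metis
  \<comment> \<open>The linearization error of \<open>v\<close> at \<open>F x\<close>, pulled back to \<open>R\<close>.\<close>
  let ?r = "\<lambda>y. w y - v' (F y)"
  have r: "(?r has_derivative (\<lambda>_. 0)) (at x within R)"
    using has_derivative_diff[OF w v'.has_derivative[OF F'(1)]] by simp
  obtain d1 where d1: "d1 > 0" and
    F_lower: "\<And>y. y \<in> R \<Longrightarrow> norm (y - x) < d1 \<Longrightarrow> c / 2 * norm (y - x) \<le> norm (F y - F x)"
  proof -
    obtain d where d: "d > 0" "\<And>y. y \<in> R \<Longrightarrow> norm (y - x) < d \<Longrightarrow>
        norm (F y - F x - F' (y - x)) \<le> c / 2 * norm (y - x)"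
      using F'(1) c(1) unfolding has_derivative_within_alt by (meson half_gt_zero)
    have "c / 2 * norm (y - x) \<le> norm (F y - F x)" if "y \<in> R" "norm (y - x) < d" for y
    proof -
      have "c * norm (y - x) \<le> norm (F' (y - x))" by (rule c)
      also have "\<dots> \<le> norm (F y - F x) + norm (F y - F x - F' (y - x))"
        by (metis norm_triangle_sub norm_minus_commute add.commute)
      finally show ?thesis using d(2)[OF that] by linarith
    qed
    with d(1) show ?thesis using that by blast
  qed
  have G: "continuous_on (F ` R) (inv_into R F)"
    using R F by (intro continuous_on_inv) auto
  show ?thesis unfolding has_derivative_within_alt
  proof (intro conjI allI impI v')
    fix e :: real assume e: "e > 0"
    then have "e * (c / 2) > 0" using c by simp
    with r obtain d2 where d2: "d2 > 0" "\<And>y. y \<in> R \<Longrightarrow> norm (y - x) < d2 \<Longrightarrow>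
        norm (?r y - ?r x) \<le> e * (c / 2) * norm (y - x)"
      unfolding has_derivative_within_alt by (metis diff_zero)
    obtain d where d: "d > 0" "\<And>z. z \<in> F ` R \<Longrightarrow> dist z (F x) < d \<Longrightarrow>
        dist (inv_into R F z) (inv_into R F (F x)) < min d1 d2"
      using G R(2) d1 d2(1) unfolding continuous_on_iff by (metis imageI min_less_iff_conj)
    have "norm (v z - v (F x) - v' (z - F x)) \<le> e * norm (z - F x)"
      if z: "z \<in> F ` R" "norm (z - F x) < d" for z
    proof -
      obtain y where y: "y \<in> R" "z = F y" using z by blast
      have near: "norm (y - x) < min d1 d2"
        using d(2)[OF z(1)] z(2) y R(2) F(2) by (simp add: dist_norm)
      have "norm (v z - v (F x) - v' (z - F x)) = norm (?r y - ?r x)"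
        using v y R(2) by (simp add: v'.diff algebra_simps)
      also have "\<dots> \<le> e * (c / 2 * norm (y - x))"
        using d2(2)[OF y(1)] near by (simp add: mult.assoc)
      also have "\<dots> \<le> e * norm (z - F x)"
        using F_lower[OF y(1)] near e y by (intro mult_left_mono) auto
      finally show ?thesis .
    qed
    with d(1) show "\<exists>d>0. \<forall>z\<in>F ` R. norm (z - F x) < d \<longrightarrow>
        norm (v z - v (F x) - v' (z - F x)) \<le> e * norm (z - F x)" by blast
  qed
qed

lemma element_map_jacobian:
  assumes "element_map s F"
  shows "continuous_on UNIV (\<lambda>x. jacobian F (at x))"
    and "(F has_derivative (\<lambda>h. jacobian F (at x) *v h)) (at x)"
proof -
  have "\<forall>i. \<exists>G. continuous_on UNIV G \<and> (\<forall>x. ((\<lambda>x. F x $ i) has_derivative (\<lambda>h. G x \<bullet> h)) (at x))"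
    using assms shape_function_C1 unfolding element_map_def C1_function_def by blast
  then obtain G where G: "\<And>i. continuous_on UNIV (G i)"
    "\<And>i x. ((\<lambda>x. F x $ i) has_derivative (\<lambda>h. G i x \<bullet> h)) (at x)" by metis
  define J where "J x = (\<chi> i j. G i x $ j)" for x
  have J: "(F has_derivative (\<lambda>h. J x *v h)) (at x)" for x
    unfolding has_derivative_componentwise_within[of F]
  proof
    fix b :: "real^'a" assume "b \<in> Basis"
    then obtain i where b: "b = axis i 1" by (auto simp: Basis_vec_def)
    have "(J x *v h) $ i = G i x \<bullet> h" for h
      by (simp add: J_def matrix_vector_mult_def inner_vec_def)
    then show "((\<lambda>x. F x \<bullet> b) has_derivative (\<lambda>h. (J x *v h) \<bullet> b)) (at x)"
      using G(2)[of i x] by (simp add: b inner_axis)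
  qed
  then have eq: "jacobian F (at x) = J x" for x
    unfolding jacobian_def using frechet_derivative_at[OF J[of x], symmetric]
    by simp
  show "(F has_derivative (\<lambda>h. jacobian F (at x) *v h)) (at x)" using J eq by simp
  show "continuous_on UNIV (\<lambda>x. jacobian F (at x))"
    unfolding eq J_def by (intro continuous_intros continuous_on_vec_lambda G)
qed

lemma element_map_continuous_on: "element_map s F \<Longrightarrow> continuous_on S F"
  by (meson continuous_at_imp_continuous_on element_map_jacobian(2) has_derivative_continuous)

lemma element_map_jacobian_bij:
  assumes "element_map s F" "x \<in> ref_element s"
  shows "bij ((*v) (jacobian F (at x)))"
proof -
  have "invertible (jacobian F (at x))"
    using assms by (simp add: element_map_def invertible_det_nz)
  then show ?thesis by (simp add: invertible_eq_bij)
qed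

lemma continuous_on_det:
  fixes A :: "'a::topological_space \<Rightarrow> real^'m^'m"
  assumes "continuous_on S A"
  shows "continuous_on S (\<lambda>x. det (A x))"
  unfolding det_def using assms by (intro continuous_intros) auto

text \<open>By the chain rule the gradient of \<open>v\<close> at \<open>F x\<close> solves the linear system
  \<open>J\<^sup>T y = \<nabla>w\<close>, where \<open>J\<close> is the Jacobian of \<open>F\<close> at \<open>x\<close>. Cramer's rule shows that the solution
  depends continuously on \<open>x\<close>, up to the boundary of the element.\<close>

lemma element_function_continuous_gradient:
  assumes F: "element_map s F" and w: "shape_function s w"
    and v: "\<And>x. x \<in> ref_element s \<Longrightarrow> v (F x) = w x"
  shows "\<exists>D. continuous_on (F ` ref_element s) D \<and>
    (\<forall>z\<in>F ` ref_element s. (v has_derivative (\<lambda>h. D z \<bullet> h)) (at z within F ` ref_element s))"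
proof -
  let ?R = "ref_element s" and ?J = "\<lambda>x. jacobian F (at x)"
  obtain G where G: "continuous_on UNIV G" "\<And>x. (w has_derivative (\<lambda>h. G x \<bullet> h)) (at x)"
    using shape_function_C1[OF w] unfolding C1_function_def by blast
  define Y where "Y x = (\<chi> k. det (\<chi> i j. if j = k then G x $ i else transpose (?J x) $ i $ j)
      / det (transpose (?J x)))" for x
  have det: "det (transpose (?J x)) \<noteq> 0" if "x \<in> ?R" for x
    using F that by (simp add: element_map_def)
  have Y: "Y x \<bullet> (?J x *v h) = G x \<bullet> h" if "x \<in> ?R" for x h
  proof -
    have "transpose (?J x) *v Y x = G x"
      unfolding cramer[OF det[OF that]] Y_def ..
    then show ?thesis by (metis dot_lmul_matrix transpose_matrix_vector)
  qed
  have J_cont: "continuous_on ?R (\<lambda>x. ?J x $ i $ j)" for i j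
    by (intro continuous_intros continuous_on_subset[OF element_map_jacobian(1)[OF F]]) auto
  have entry: "continuous_on ?R (\<lambda>x. if j = k then G x $ i else transpose (?J x) $ i $ j)" for i j k
    using continuous_on_subset[OF G(1)] J_cont
    by (cases "j = k") (auto simp: transpose_def intro!: continuous_intros)
  have Y_cont: "continuous_on ?R Y"
    unfolding Y_def
    by (intro continuous_on_vec_lambda continuous_on_divide continuous_on_det entry ballI det)
       (simp add: transpose_def, intro continuous_on_vec_lambda J_cont)
  have inj: "inj_on F ?R" using F by (simp add: element_map_def)
  have F_cont: "continuous_on ?R F" by (rule element_map_continuous_on[OF F])
  have "continuous_on (F ` ?R) (\<lambda>z. Y (inv_into ?R F z))"
    using inj F_cont ref_element_convex_body(1)
    by (intro continuous_on_compose2[OF Y_cont] continuous_on_inv) (auto simp: inv_into_into)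
  moreover have "(v has_derivative (\<lambda>h. Y (inv_into ?R F z) \<bullet> h)) (at z within F ` ?R)"
    if z: "z \<in> F ` ?R" for z
  proof -
    obtain x where x: "x \<in> ?R" "z = F x" using z by blast
    have "(v has_derivative (\<lambda>h. Y x \<bullet> h)) (at (F x) within F ` ?R)"
    proof (rule has_derivative_on_parametrized_set[where w = w and F' = "(*v) (?J x)"])
      show "(F has_derivative (*v) (?J x)) (at x within ?R)"
        using element_map_jacobian(2)[OF F] has_derivative_at_withinI by blast
      show "(w has_derivative (\<lambda>h. Y x \<bullet> (?J x *v h))) (at x within ?R)"
        unfolding Y[OF x(1)] using G(2) has_derivative_at_withinI by blast
      show "inj ((*v) (?J x))" using element_map_jacobian_bij[OF F x(1)] by (rule bij_is_inj)
    qed (use x F_cont inj v ref_element_convex_body(1) bounded_linear_inner_right in auto)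
    then show ?thesis using x inj by simp
  qed
  ultimately show ?thesis by blast
qed

text \<open>An element need not be convex, but composing with its parametrization moves the question to the
  convex reference element.\<close>

lemma element_derivative_unique:
  fixes f :: "real^'m \<Rightarrow> 'b::real_normed_vector"
  assumes F: "element_map s F" and z: "z \<in> F ` ref_element s"
    and D: "(f has_derivative D) (at z within F ` ref_element s)"
      "(f has_derivative D') (at z within F ` ref_element s)"
  shows "D = D'"
proof -
  let ?R = "ref_element s"
  obtain x where x: "x \<in> ?R" "z = F x" using z by blast
  let ?J = "(*v) (jacobian F (at x))"
  have J: "(F has_derivative ?J) (at x within ?R)"
    using element_map_jacobian(2)[OF F] has_derivative_at_withinI by blast
  have "D \<circ> ?J = D' \<circ> ?J"
    using D ref_element_convex_body(2,3) x J
    by (intro has_derivative_within_convex_unique[where S = ?R and f = "f \<circ> F"] diff_chain_within) auto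
  then have eq: "D (?J h) = D' (?J h)" for h by (metis comp_apply)
  have "surj ?J" using element_map_jacobian_bij[OF F x(1)] by (rule bij_is_surj)
  then show ?thesis using eq by (metis ext surjD)
qed

text \<open>By invariance of domain the image of the interior is open, so what remains is part of the image
  of the frontier of a convex set under a differentiable map.\<close>

lemma element_boundary_negligible:
  assumes F: "element_map s F"
  shows "negligible (F ` ref_element s - interior (F ` ref_element s))"
proof -
  let ?R = "ref_element s :: (real^'a) set"
  have "inj_on F (interior ?R)"
    using F inj_on_subset[OF _ interior_subset] by (auto simp: element_map_def)
  then have "open (F ` interior ?R)"
    by (intro invariance_of_domain element_map_continuous_on[OF F] open_interior)
  then have "F ` interior ?R \<subseteq> interior (F ` ?R)"
    by (simp add: image_mono interior_maximal interior_subset)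
  moreover have "?R \<subseteq> interior ?R \<union> frontier ?R"
    by (metis closure_Un_frontier closure_subset Diff_partition frontier_def interior_subset closure_subset subset_trans)
  ultimately have "F ` ?R - interior (F ` ?R) \<subseteq> F ` frontier ?R" by blast
  moreover have "negligible (F ` frontier ?R)"
  proof (rule negligible_differentiable_image_negligible)
    show "F differentiable_on frontier ?R"
      using element_map_jacobian(2)[OF F] unfolding differentiable_on_def
      by (meson differentiableI differentiable_at_withinI)
  qed (auto intro: negligible_convex_frontier ref_element_convex_body)
  ultimately show ?thesis by (rule negligible_subset[rotated])
qed

lemma conforming_grid_element:
  assumes "conforming_grid \<Omega> \<G> T F" "e \<in> \<G>"
  shows "element_map (T e) (F e)" "e = F e ` ref_element (T e)"
  using assms by (auto simp: conforming_grid_def)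

lemma basis_shape_function:
  assumes "lagrange_basis \<Omega> \<G> T F p \<theta>" "e \<in> \<G>"
  shows "\<exists>w. shape_function (T e) w \<and> (\<forall>x\<in>ref_element (T e). \<theta> i (F e x) = w x)"
  using assms unfolding lagrange_basis_def fe_function_def by blast

lemma basis_gradients:
  assumes grid: "conforming_grid \<Omega> \<G> T F" and basis: "lagrange_basis \<Omega> \<G> T F p \<theta>"
  obtains D where "\<And>i e. e \<in> \<G> \<Longrightarrow> continuous_on e (D i e)"
    "\<And>i e z. e \<in> \<G> \<Longrightarrow> z \<in> e \<Longrightarrow> (\<theta> i has_derivative (\<lambda>h. D i e z \<bullet> h)) (at z within e)"
proof -
  have "\<exists>D. continuous_on e D \<and> (\<forall>z\<in>e. (\<theta> i has_derivative (\<lambda>h. D z \<bullet> h)) (at z within e))"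
    if e: "e \<in> \<G>" for e i
  proof -
    note el = conforming_grid_element[OF grid e]
    obtain w where "shape_function (T e) w" "\<And>x. x \<in> ref_element (T e) \<Longrightarrow> \<theta> i (F e x) = w x"
      using basis_shape_function[OF basis e] by blast
    from element_function_continuous_gradient[OF el(1) this] show ?thesis
      using el(2) by simp
  qed
  then obtain D where "\<And>e i. e \<in> \<G> \<Longrightarrow> continuous_on e (D e i) \<and>
      (\<forall>z\<in>e. (\<theta> i has_derivative (\<lambda>h. D e i z \<bullet> h)) (at z within e))" by metis
  then show ?thesis by (intro that[of "\<lambda>i e. D e i"]) auto
qed

lemma fe_fun_has_derivative:
  assumes "\<And>i. (\<theta> i has_derivative (\<lambda>h. D i \<bullet> h)) net"
  shows "(fe_fun \<theta> c has_derivative (\<lambda>h. \<Sum>i\<in>UNIV. (D i \<bullet> h) *\<^sub>R c$i)) net"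
  unfolding fe_fun_def[abs_def] using assms by (intro has_derivative_sum has_derivative_scaleR_left)

lemma transpose_strain: "transpose (strain \<theta> u net) = strain \<theta> u net"
  by (simp add: strain_def transpose_def vec_eq_iff)

text \<open>The definition of the Jacobian chooses some derivative. It depends linearly on \<open>u\<close> only because
  there is no choice: the derivative within an element is unique.\<close>

lemma linear_strain:
  fixes \<theta> :: "'M::finite \<Rightarrow> real^'m \<Rightarrow> real"
  assumes grid: "conforming_grid \<Omega> \<G> T F" and basis: "lagrange_basis \<Omega> \<G> T F p \<theta>"
    and e: "e \<in> \<G>" and z: "z \<in> e"
  shows "linear (\<lambda>u. strain \<theta> u (at z within e))"
proof -
  obtain D' where "\<And>i e. e \<in> \<G> \<Longrightarrow> continuous_on e (D' i e)" and
    "\<And>i e z. e \<in> \<G> \<Longrightarrow> z \<in> e \<Longrightarrow> (\<theta> i has_derivative (\<lambda>h. D' i e z \<bullet> h)) (at z within e)"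
    using basis_gradients[OF grid basis] by blast
  note D' = this(2)
  define D where "D i = D' i e z" for i
  have D: "(\<theta> i has_derivative (\<lambda>h. D i \<bullet> h)) (at z within e)" for i
    unfolding D_def by (rule D'[OF e z])
  note el = conforming_grid_element[OF grid e]
  have jac: "jacobian (fe_fun \<theta> u) (at z within e) = (\<chi> a b. \<Sum>i\<in>UNIV. D i $ b * u $ i $ a)"
    for u :: "real^'m^'M"
  proof -
    let ?D = "\<lambda>h. \<Sum>i\<in>UNIV. (D i \<bullet> h) *\<^sub>R u $ i"
    have D': "(fe_fun \<theta> u has_derivative ?D) (at z within e)"
      by (rule fe_fun_has_derivative[OF D])
    then have "(fe_fun \<theta> u has_derivative frechet_derivative (fe_fun \<theta> u) (at z within e)) (at z within e)"
      by (meson differentiableI frechet_derivative_works)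
    with D' z have "frechet_derivative (fe_fun \<theta> u) (at z within e) = ?D"
      by (intro element_derivative_unique[OF el(1), of z "fe_fun \<theta> u"]) (simp_all flip: el(2))
    then show ?thesis
      by (simp add: jacobian_def matrix_def inner_axis)
  qed
  show ?thesis
    unfolding strain_def jac
    by (rule linearI)
       (simp_all add: vec_eq_iff transpose_def sum.distrib sum_distrib_left algebra_simps)
qed

text \<open>With \<open>C = {0..1}\<close> this keeps the damage in the interval on which the degradation function is
  differentiable.\<close>

lemma fe_fun_in_convex:
  fixes d :: "real^'M::finite"
  assumes grid: "conforming_grid \<Omega> \<G> T F" and basis: "lagrange_basis \<Omega> \<G> T F p \<theta>"
    and e: "e \<in> \<G>" and z: "z \<in> e" and C: "convex C" and d: "\<And>i. d $ i \<in> C"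
  shows "fe_fun \<theta> d z \<in> C"
proof -
  note el = conforming_grid_element[OF grid e]
  obtain x where x: "x \<in> ref_element (T e)" "z = F e x" using z el(2) by blast
  obtain w where w: "\<And>i. shape_function (T e) (w i)"
    "\<And>i x. x \<in> ref_element (T e) \<Longrightarrow> \<theta> i (F e x) = w i x"
    using basis_shape_function[OF basis e] by metis
  let ?w = "\<lambda>x. \<Sum>i\<in>UNIV. w i x * d $ i"
  have eq: "fe_fun \<theta> d (F e y) = ?w y" if "y \<in> ref_element (T e)" for y
    using w(2) that by (simp add: fe_fun_def)
  have "?w y \<in> C" if y: "y \<in> ref_vertices (T e)" for y
  proof -
    have "y \<in> ref_element (T e)" using y by (simp add: ref_element_def hull_inc)
    moreover obtain j where "F e y = p j"
      using basis e y unfolding lagrange_basis_def by blast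
    moreover have "fe_fun \<theta> d (p j) = d $ j" for j
      using basis by (simp add: lagrange_basis_def fe_fun_def if_distrib[of "\<lambda>x. x * _"] cong: if_cong)
    ultimately show ?thesis using eq d by metis
  qed
  then have "?w x \<in> C"
    using shape_function_in_convex[OF shape_function_lincomb[of UNIV "T e" w "($) d"] C] w(1) x(1) by blast
  then show ?thesis using eq x by simp
qed

section \<open>The crack energy as a quadratic polynomial\<close>

lemma absolutely_integrable_continuous_compact:
  fixes f :: "'a::euclidean_space \<Rightarrow> 'b::euclidean_space"
  assumes "compact K" "continuous_on K f"
  shows "f absolutely_integrable_on K"
proof -
  have "integrable lborel (\<lambda>x. indicator K x *\<^sub>R f x)"
    by (rule borel_integrable_compact[OF assms])
  then show ?thesis
    unfolding set_integrable_def by (subst integrable_completion) auto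
qed

lemma grid_element_interiors_cover:
  assumes grid: "conforming_grid \<Omega> \<G> T F"
  shows "negligible (\<Omega> - (\<Union>e\<in>\<G>. interior e))"
proof -
  have "negligible (\<Union>e\<in>\<G>. e - interior e)"
  proof (rule negligible_Union)
    show "finite ((\<lambda>e. e - interior e) ` \<G>)" using grid by (simp add: conforming_grid_def)
    fix N assume "N \<in> (\<lambda>e. e - interior e) ` \<G>"
    then obtain e where e: "e \<in> \<G>" "N = e - interior e" by blast
    show "negligible N"
      using element_boundary_negligible[OF conforming_grid_element(1)[OF grid e(1)]]
        conforming_grid_element(2)[OF grid e(1)] e(2) by simp
  qed
  moreover have "\<Omega> \<subseteq> \<Union>\<G>" using grid closure_subset[of \<Omega>] by (simp add: conforming_grid_def)
  ultimately show ?thesis by (elim negligible_subset) auto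
qed

text \<open>The functions \<open>g e\<close> stand for gradients of finite element functions, which jump across element
  boundaries but extend continuously from the interior of each element to its closure.\<close>

lemma absolutely_integrable_elementwise:
  fixes f :: "real^'m \<Rightarrow> real"
  assumes grid: "conforming_grid \<Omega> \<G> T F" and \<Omega>: "open \<Omega>"
    and f: "\<And>e. e \<in> \<G> \<Longrightarrow> continuous_on e (g e)"
      "\<And>e x. e \<in> \<G> \<Longrightarrow> x \<in> interior e \<Longrightarrow> f x = g e x"
  shows "f absolutely_integrable_on \<Omega>"
proof -
  have "f absolutely_integrable_on (\<Union>e\<in>\<G>. \<Omega> \<inter> interior e)"
  proof (rule set_integrable_UN)
    show "finite \<G>" using grid by (simp add: conforming_grid_def)
    fix e assume e: "e \<in> \<G>"
    show meas: "\<Omega> \<inter> interior e \<in> sets lebesgue" using \<Omega> by (simp add: open_Int)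
    have "compact (F e ` ref_element (T e))"
      by (intro compact_continuous_image ref_element_convex_body
          element_map_continuous_on[OF conforming_grid_element(1)[OF grid e]])
    then have "compact e" using conforming_grid_element(2)[OF grid e] by simp
    then have "g e absolutely_integrable_on e"
      using f(1)[OF e] by (rule absolutely_integrable_continuous_compact)
    then have "g e absolutely_integrable_on (\<Omega> \<inter> interior e)"
      by (rule set_integrable_subset[OF _ meas]) (use interior_subset in blast)
    then show "f absolutely_integrable_on (\<Omega> \<inter> interior e)"
      using absolutely_integrable_spike_eq[of "{}" "\<Omega> \<inter> interior e" f "g e"] f(2)[OF e] by simp
  qed
  moreover have "negligible {x \<in> (\<Union>e\<in>\<G>. \<Omega> \<inter> interior e) - \<Omega>. f x \<noteq> 0}"
    by (rule negligible_subset[of "{}"]) auto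
  moreover have "negligible {x \<in> \<Omega> - (\<Union>e\<in>\<G>. \<Omega> \<inter> interior e). f x \<noteq> 0}"
    by (rule negligible_subset[OF grid_element_interiors_cover[OF grid]]) auto
  ultimately show ?thesis using absolutely_integrable_spike_set_eq by blast
qed

text \<open>Integrability of the coefficients is essential here: an integral that does not exist has the
  default value 0, so the polynomial form of the integrand alone would say nothing about the
  integral.\<close>

lemma crack_energy_quadratic:
  fixes \<theta> :: "'M::finite \<Rightarrow> real^'m \<Rightarrow> real"
  assumes grid: "conforming_grid \<Omega> \<G> T F" and \<Omega>: "open \<Omega>"
    and basis: "lagrange_basis \<Omega> \<G> T F p \<theta>"
  shows "\<exists>A B. \<forall>d::real^'M. (LINT x:\<Omega>|lebesgue. gc * crack_density \<beta> l (fe_fun \<theta> d x) (gradient (fe_fun \<theta> d) (at x)))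
     = (\<Sum>i\<in>UNIV. A i * d$i) + (\<Sum>i\<in>UNIV. \<Sum>j\<in>UNIV. B i j * (d$i * d$j))"
proof -
  obtain D where D: "\<And>i e. e \<in> \<G> \<Longrightarrow> continuous_on e (D i e)"
    "\<And>i e z. e \<in> \<G> \<Longrightarrow> z \<in> e \<Longrightarrow> (\<theta> i has_derivative (\<lambda>h. D i e z \<bullet> h)) (at z within e)"
    using basis_gradients[OF grid basis] by blast
  define G where "G i x = gradient (\<theta> i) (at x)" for i x
  have at: "(\<theta> i has_derivative (\<lambda>h. D i e x \<bullet> h)) (at x)" if "e \<in> \<G>" "x \<in> interior e" for i e x
    using D(2)[of e x i] that interior_subset by (metis at_within_interior subsetD)
  have G: "G i x = D i e x" if "e \<in> \<G>" "x \<in> interior e" for i e x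
    unfolding G_def using gradient_eq_within_convex[of UNIV x "\<theta> i"] at[OF that] by simp
  have grad: "gradient (fe_fun \<theta> d) (at x) = (\<Sum>i\<in>UNIV. d$i *\<^sub>R G i x)"
    if e: "e \<in> \<G>" "x \<in> interior e" for d :: "real^'M" and e x
  proof -
    have "(fe_fun \<theta> d has_derivative (\<lambda>h. (\<Sum>i\<in>UNIV. d$i *\<^sub>R G i x) \<bullet> h)) (at x)"
      using fe_fun_has_derivative[OF at[OF e], where c = d] by (simp add: G[OF e] inner_sum_left mult.commute)
    then show ?thesis using gradient_eq_within_convex[of UNIV x] by simp
  qed
  define ka kb kG where "ka = gc / (4 * c_w \<beta>) * ((1 + \<beta>) / l)"
    and "kb = gc / (4 * c_w \<beta>) * (\<beta> / l)" and "kG = gc / (4 * c_w \<beta>) * l"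
  define a where "a i x = ka * \<theta> i x" for i x
  define b where "b i j x = kG * (G i x \<bullet> G j x) - kb * (\<theta> i x * \<theta> j x)" for i j x
  have expand: "gc * (1 / (4 * c_w \<beta>) * ((1 + \<beta> * (1 - s)) * s / l + l * n))
      = ka * s + (kG * n - kb * (s * s))" for s n
    unfolding ka_def kb_def kG_def divide_inverse by (simp add: algebra_simps)
  have \<theta>_cont: "continuous_on e (\<theta> i)" if "e \<in> \<G>" for e i
    using D(2)[OF that] by (meson continuous_on_eq_continuous_within has_derivative_continuous)
  have a: "a i absolutely_integrable_on \<Omega>" for i
    by (rule absolutely_integrable_elementwise[OF grid \<Omega>, where g = "\<lambda>_. a i"])
       (auto simp: a_def[abs_def] intro!: continuous_intros \<theta>_cont)
  have b: "b i j absolutely_integrable_on \<Omega>" for i j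
    by (rule absolutely_integrable_elementwise[OF grid \<Omega>,
          where g = "\<lambda>e x. kG * (D i e x \<bullet> D j e x) - kb * (\<theta> i x * \<theta> j x)"])
       (auto simp: b_def G intro!: continuous_intros \<theta>_cont D(1))
  have "(LINT x:\<Omega>|lebesgue. gc * crack_density \<beta> l (fe_fun \<theta> d x) (gradient (fe_fun \<theta> d) (at x)))
      = (\<Sum>i\<in>UNIV. integral \<Omega> (a i) * d$i) + (\<Sum>i\<in>UNIV. \<Sum>j\<in>UNIV. integral \<Omega> (b i j) * (d$i * d$j))"
    (is "(LINT x:\<Omega>|lebesgue. ?f x) = ?I") for d :: "real^'M"
  proof -
    let ?q = "\<lambda>x. (\<Sum>i\<in>UNIV. a i x * d$i) + (\<Sum>i\<in>UNIV. \<Sum>j\<in>UNIV. b i j x * (d$i * d$j))"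
    have q: "?q absolutely_integrable_on \<Omega>"
      by (intro set_integral_add(1) absolutely_integrable_sum set_integrable_mult_left a b) auto
    have "(?q has_integral ?I) \<Omega>"
      by (intro has_integral_add has_integral_sum has_integral_mult_left integrable_integral
          set_lebesgue_integral_eq_integral(1) a b) auto
    have eq: "?f x = ?q x" if x: "x \<in> \<Omega> - (\<Omega> - (\<Union>e\<in>\<G>. interior e))" for x
    proof -
      obtain e where e: "e \<in> \<G>" "x \<in> interior e" using x by blast
      let ?s = "\<Sum>i\<in>UNIV. d$i * \<theta> i x"
      \<comment> \<open>\<open>?s\<close> is the damage at \<open>x\<close>; the dissipation contributes a linear and a square term in it.\<close>
      have s: "fe_fun \<theta> d x = ?s" by (simp add: fe_fun_def mult.commute)
      have ss: "?s * ?s = (\<Sum>i\<in>UNIV. \<Sum>j\<in>UNIV. (d$i * \<theta> i x) * (d$j * \<theta> j x))"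
        by (rule sum_product)
      have GG: "(norm (gradient (fe_fun \<theta> d) (at x)))\<^sup>2
          = (\<Sum>i\<in>UNIV. \<Sum>j\<in>UNIV. (d$i * d$j) * (G i x \<bullet> G j x))"
        unfolding grad[OF e] power2_norm_eq_inner
        by (simp only: inner_sum_left, simp only: inner_sum_right, simp add: mult.assoc mult.left_commute)
      have "?f x = ka * ?s + (kG * (norm (gradient (fe_fun \<theta> d) (at x)))\<^sup>2 - kb * (?s * ?s))"
        unfolding crack_density_def local_dissipation_def s
        by (rule expand)
      also have "\<dots> = (\<Sum>i\<in>UNIV. ka * (d$i * \<theta> i x)) + (\<Sum>i\<in>UNIV. \<Sum>j\<in>UNIV.
          kG * ((d$i * d$j) * (G i x \<bullet> G j x)) - kb * ((d$i * \<theta> i x) * (d$j * \<theta> j x)))"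
        unfolding ss GG by (simp add: sum_distrib_left sum_subtractf)
      also have "\<dots> = ?q x" unfolding a_def b_def by (simp add: algebra_simps)
      finally show ?thesis .
    qed
    have "?f absolutely_integrable_on \<Omega>"
      by (rule absolutely_integrable_spike[OF q grid_element_interiors_cover[OF grid] eq])
    then have "(LINT x:\<Omega>|lebesgue. ?f x) = integral \<Omega> ?f"
      by (rule set_lebesgue_integral_eq_integral)
    also have "\<dots> = integral \<Omega> ?q"
      by (rule integral_spike[OF grid_element_interiors_cover[OF grid]]) (use eq in auto)
    also have "\<dots> = ?I" using \<open>(?q has_integral ?I) \<Omega>\<close> by (rule integral_unique)
    finally show ?thesis .
  qed
  then show ?thesis
    by (intro exI[of _ "\<lambda>i. integral \<Omega> (a i)"] exI[of _ "\<lambda>i j. integral \<Omega> (b i j)"] allI)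
qed

section \<open>Differentiability of the smooth part\<close>

lemma degradation_function_differentiable:
  assumes "degradation_function g" "x \<in> {0..1}"
  shows "g differentiable (at x within {0..1})"
  using assms unfolding degradation_function_def C2_on_unit_interval_def
  by (meson has_field_derivative_imp_has_derivative differentiableI)

lemma J0_differentiable:
  fixes \<theta> :: "'M::finite \<Rightarrow> real^'m \<Rightarrow> real" and q :: "(real^'m) set \<Rightarrow> nat \<Rightarrow> real^'m"
  assumes grid: "conforming_grid \<Omega> \<G> T F" and basis: "lagrange_basis \<Omega> \<G> T F p \<theta>"
    and \<Omega>: "open \<Omega>" and q: "\<And>e \<alpha>. e \<in> \<G> \<Longrightarrow> \<alpha> \<in> {1..amax} \<Longrightarrow> q e \<alpha> \<in> e"
    and g: "degradation_function g" and Pext: "linear Pext" and U: "U \<in> damage_box"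
  shows "J0 (energy_density sp lam mu g k) (crack_density \<beta> l) gc \<Omega> \<G> \<theta> amax q \<omega> Pext
    differentiable (at U within damage_box)"
proof -
  let ?net = "at U within (damage_box :: ((real^'m^'M) \<times> (real^'M)) set)"
  obtain P N :: "real^'m^'m \<Rightarrow> real"
    where diff: "\<forall>A. P differentiable (at A) \<and> N differentiable (at A)"
      and ext: "\<forall>A. transpose A = A \<longrightarrow> psi0_plus sp lam mu A = P A \<and> psi0_minus sp lam mu A = N A"
    using split_energies_differentiable_extension[of sp lam mu] by blast
  obtain A B where AB: "\<forall>d::real^'M. (LINT x:\<Omega>|lebesgue. gc * crack_density \<beta> l (fe_fun \<theta> d x)
      (gradient (fe_fun \<theta> d) (at x)))
     = (\<Sum>i\<in>UNIV. A i * d$i) + (\<Sum>i\<in>UNIV. \<Sum>j\<in>UNIV. B i j * (d$i * d$j))"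
    using crack_energy_quadratic[OF grid \<Omega> basis, of gc \<beta> l] by blast
  have fst: "fst differentiable ?net" and snd: "snd differentiable ?net"
    by (intro bounded_linear_imp_differentiable bounded_linear_fst bounded_linear_snd)+
  have lin: "(\<lambda>W. L (h W)) differentiable ?net" if "linear L" "h differentiable ?net"
    for L :: "'x::euclidean_space \<Rightarrow> 'y::euclidean_space" and h
    using linear_imp_differentiable[OF that(1)] that(2) by (rule differentiable_compose)
  have nth: "(\<lambda>W. snd W $ i) differentiable ?net" for i
    by (rule lin[OF bounded_linear.linear[OF bounded_linear_vec_nth] snd])
  have density: "(\<lambda>W. energy_density sp lam mu g k (strain \<theta> (fst W) (at z within e)) (fe_fun \<theta> (snd W) z))
      differentiable ?net" if e: "e \<in> \<G>" and z: "z \<in> e" for e z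
  proof -
    have strain: "(\<lambda>W. strain \<theta> (fst W) (at z within e)) differentiable ?net"
      by (rule lin[OF linear_strain[OF grid basis e z] fst])
    have "(\<lambda>W. P (strain \<theta> (fst W) (at z within e))) differentiable ?net"
      "(\<lambda>W. N (strain \<theta> (fst W) (at z within e))) differentiable ?net"
      by (rule differentiable_compose[OF _ strain], simp add: diff)+
    moreover have "(\<lambda>W. g (fe_fun \<theta> (snd W) z)) differentiable ?net"
    proof (rule differentiable_in_compose[where f = g and g = "\<lambda>W. fe_fun \<theta> (snd W) z"])
      have maps: "(\<lambda>W. fe_fun \<theta> (snd W) z) ` damage_box \<subseteq> {0..1}"
        by (intro image_subsetI fe_fun_in_convex[OF grid basis e z]) (auto simp: damage_box_def)
      then have "fe_fun \<theta> (snd U) z \<in> {0..1}" using U by blast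
      then show "g differentiable (at (fe_fun \<theta> (snd U) z) within (\<lambda>W. fe_fun \<theta> (snd W) z) ` damage_box)"
        using degradation_function_differentiable[OF g] maps by (blast intro: differentiable_within_subset)
      show "(\<lambda>W. fe_fun \<theta> (snd W) z) differentiable ?net"
        unfolding fe_fun_def by (auto intro!: derivative_intros nth)
    qed
    ultimately show ?thesis
      unfolding energy_density_def by (simp add: ext transpose_strain)
  qed
  have fin: "finite \<G>" using grid by (simp add: conforming_grid_def)
  have "(\<lambda>W. (\<Sum>e\<in>\<G>. \<Sum>\<alpha>=1..amax. energy_density sp lam mu g k
        (strain \<theta> (fst W) (at (q e \<alpha>) within e)) (fe_fun \<theta> (snd W) (q e \<alpha>)) * \<omega> e \<alpha>) +
      ((\<Sum>i\<in>UNIV. A i * snd W$i) + (\<Sum>i\<in>UNIV. \<Sum>j\<in>UNIV. B i j * (snd W$i * snd W$j))) +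
      Pext (fst W)) differentiable ?net"
    using fin lin[OF Pext fst]
    by (intro differentiable_add differentiable_sum differentiable_mult differentiable_const nth
        density q ballI) auto
  then show ?thesis by (simp only: J0_def split_beta' AB)
qed

section \<open>From blockwise stationarity to first-order optimality\<close>

lemma irreversibility_eq:
  "irreversibility dn d = (if \<forall>i. d$i \<in> {dn$i..1} then 0 else \<infinity>)"
  by (auto simp: irreversibility_def indicator_functional_def sum_Pinfty intro!: sum.neutral)

lemma effective_domain_functional_J:
  "effective_domain (functional_J f dn) = {W. \<forall>i. snd W $ i \<in> {dn$i..1}}"
  by (auto simp: effective_domain_def functional_J_def irreversibility_eq split: if_splits)

lemma functional_J_le_iff:
  assumes "U \<in> effective_domain (functional_J f dn)" "V \<in> effective_domain (functional_J f dn)"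
  shows "functional_J f dn U \<le> functional_J f dn V \<longleftrightarrow> f U \<le> f V"
  using assms unfolding effective_domain_functional_J
  by (auto simp: functional_J_def irreversibility_eq split_beta)

text \<open>Only the segment from \<open>U\<close> to \<open>U + V\<close> has to lie in \<open>S\<close>, which is all that is available when
  damage values sit at the ends of their intervals.\<close>

lemma directional_derivative_nonneg:
  fixes f :: "'a::real_normed_vector \<Rightarrow> real"
  assumes D: "(f has_derivative D) (at U within S)"
    and le: "\<And>t. t \<in> {0..1} \<Longrightarrow> U + t *\<^sub>R V \<in> S \<and> f U \<le> f (U + t *\<^sub>R V)"
  shows "D V \<ge> 0"
proof (rule ccontr)
  assume neg: "\<not> D V \<ge> 0"
  interpret D: bounded_linear D using D by (rule has_derivative_bounded_linear)
  let ?l = "\<lambda>t::real. U + t *\<^sub>R V"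
  have "(?l has_derivative (\<lambda>t. t *\<^sub>R V)) (at 0 within {0..1})"
    by (auto intro!: derivative_eq_intros)
  moreover have "(f has_derivative D) (at (?l 0) within ?l ` {0..1})"
  proof -
    have "?l ` {0..1} \<subseteq> S" using le by blast
    then show ?thesis using has_derivative_subset[OF D] by simp
  qed
  ultimately have "((f \<circ> ?l) has_derivative (D \<circ> (\<lambda>t. t *\<^sub>R V))) (at 0 within {0..1})"
    by (rule diff_chain_within)
  then have "((f \<circ> ?l) has_real_derivative D V) (at 0 within {0..1})"
    by (simp add: has_field_derivative_def o_def D.scaleR mult_commute_abs)
  from has_real_derivative_neg_dec_right[OF this] neg obtain d where
    d: "d > 0" "\<And>h. h > 0 \<Longrightarrow> h \<in> {0..1} \<Longrightarrow> h < d \<Longrightarrow> f (U + h *\<^sub>R V) < f U"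
    by auto
  let ?h = "min 1 (d / 2)"
  have "f (U + ?h *\<^sub>R V) < f U" using d by (intro d(2)) auto
  moreover have "f U \<le> f (U + ?h *\<^sub>R V)" using le[of ?h] d(1) by auto
  ultimately show False by simp
qed

lemma linear_functional_inner:
  fixes D :: "'a::euclidean_space \<Rightarrow> real"
  assumes "linear D"
  obtains G where "D = (\<lambda>h. G \<bullet> h)"
proof
  have "D h = (\<Sum>b\<in>Basis. D b *\<^sub>R b) \<bullet> h" for h
  proof -
    have "D h = D (\<Sum>b\<in>Basis. (h \<bullet> b) *\<^sub>R b)" by (simp add: euclidean_representation)
    also have "\<dots> = (\<Sum>b\<in>Basis. (h \<bullet> b) *\<^sub>R D b)"
      by (simp add: linear_sum[OF assms] linear_scale[OF assms])
    finally show ?thesis by (simp add: inner_sum_left inner_commute[of h] mult.commute)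
  qed
  then show "D = (\<lambda>h. (\<Sum>b\<in>Basis. D b *\<^sub>R b) \<bullet> h)" by blast
qed

lemma sum_axis_nth: "(\<Sum>j\<in>UNIV. axis j (z $ j)) = z"
  by (simp add: vec_eq_iff axis_def if_distrib[of "\<lambda>x. x $ _"] cong: if_cong)

text \<open>The constraint is a product of intervals over the nodes. So each block of \<open>W - U\<close> is by itself
  an admissible direction, and linearity of \<open>D\<close> recovers \<open>W - U\<close> from the blocks.\<close>

lemma blockwise_stationary_imp_first_order:
  fixes f :: "(real^'m^'M::finite) \<times> (real^'M) \<Rightarrow> real"
  assumes dn: "\<And>i. dn$i \<ge> 0"
    and D: "(f has_derivative D) (at U within damage_box)"
    and U: "U \<in> effective_domain (functional_J f dn)"
    and disp: "\<And>j V. V \<in> V_displacement j \<Longrightarrow> functional_J f dn U \<le> functional_J f dn (U + V)"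
    and dam: "\<And>j V. V \<in> V_damage j \<Longrightarrow> functional_J f dn U \<le> functional_J f dn (U + V)"
    and W: "W \<in> effective_domain (functional_J f dn)"
  shows "D (W - U) \<ge> 0"
proof -
  interpret D: bounded_linear D using D by (rule has_derivative_bounded_linear)
  let ?dom = "effective_domain (functional_J f dn)"
  note dom = effective_domain_functional_J[of f dn]
  have dom_box: "V \<in> damage_box" if "V \<in> ?dom" for V
    using that dn unfolding dom by (auto simp: damage_box_def split_beta intro: order_trans)
  have nonneg: "D V \<ge> 0"
    if "\<And>t. t \<in> {0..1} \<Longrightarrow> U + t *\<^sub>R V \<in> ?dom"
      and "\<And>t. functional_J f dn U \<le> functional_J f dn (U + t *\<^sub>R V)" for V
    using that functional_J_le_iff[OF U] dom_box
    by (intro directional_derivative_nonneg[OF D]) blast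
  define x where "x = fst (W - U)"
  define y where "y = snd (W - U)"
  have "0 \<le> D (axis j (x $ j), 0)" for j
  proof (rule nonneg)
    show "U + t *\<^sub>R (axis j (x $ j), 0) \<in> ?dom" for t using U by (simp add: dom)
    show "functional_J f dn U \<le> functional_J f dn (U + t *\<^sub>R (axis j (x $ j), 0))" for t
      by (rule disp[of _ j]) (simp add: V_displacement_def axis_def)
  qed
  moreover have "0 \<le> D (0, axis j (y $ j))" for j
  proof (rule nonneg)
    show "U + t *\<^sub>R (0, axis j (y $ j)) \<in> ?dom" if t: "t \<in> {0..1}" for t
    proof -
      have "(1 - t) *\<^sub>R (snd U $ j) + t *\<^sub>R (snd W $ j) \<in> {dn$j..1}"
        using U W t unfolding dom by (intro convexD) auto
      then show ?thesis using U by (auto simp: dom axis_def y_def algebra_simps)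
    qed
    show "functional_J f dn U \<le> functional_J f dn (U + t *\<^sub>R (0, axis j (y $ j)))" for t
      by (rule dam[of _ j]) (simp add: V_damage_def axis_def)
  qed
  moreover have "W - U = (\<Sum>j\<in>UNIV. (axis j (x $ j), 0)) + (\<Sum>j\<in>UNIV. (0, axis j (y $ j)))"
    using sum_axis_nth[of x] sum_axis_nth[of y]
    by (simp add: prod_eq_iff fst_sum snd_sum) (simp add: x_def y_def)
  ultimately show ?thesis by (simp add: D.add D.sum sum_nonneg)
qed

theorem proposition4p3:
  fixes lam mu k \<beta> l gc :: real
    and g :: "real \<Rightarrow> real"
    and sp :: energy_split
    and \<Omega> :: "(real^'m) set"
    and \<G> :: "(real^'m) set set"
    and T :: "(real^'m) set \<Rightarrow> ref_shape"
    and F :: "(real^'m) set \<Rightarrow> real^'m \<Rightarrow> real^'m"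
    and p :: "'M::finite \<Rightarrow> real^'m"
    and \<theta> :: "'M \<Rightarrow> real^'m \<Rightarrow> real"
    and amax :: nat
    and q :: "(real^'m) set \<Rightarrow> nat \<Rightarrow> real^'m"
    and \<omega> :: "(real^'m) set \<Rightarrow> nat \<Rightarrow> real"
    and Pext :: "real^'m^'M \<Rightarrow> real"
    and dn :: "real^'M"
    and U :: "(real^'m^'M) \<times> (real^'M)"
  defines "\<psi> \<equiv> energy_density sp lam mu g k"
    and "\<gamma> \<equiv> crack_density \<beta> l"
  defines "\<J>\<^sub>0 \<equiv> J0 \<psi> \<gamma> gc \<Omega> \<G> \<theta> amax q \<omega> Pext"
  defines "\<J> \<equiv> functional_J \<J>\<^sub>0 dn"
  assumes mu: "mu > 0" and lam: "lam > - (2/3) * mu"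
    and psi0: "strongly_convex_on (sym_matrices :: (real^'m^'m) set) (psi0 lam mu)"
    and g: "degradation_function g" and k: "k > 0"
    and split: "sp = Spectral \<Longrightarrow> lam \<ge> 0"
    and l: "l > 0" and beta: "\<beta> \<in> {-1..0}" and gc: "gc > 0"
    and domain: "polyhedral_domain \<Omega>"
    and grid: "conforming_grid \<Omega> \<G> T F"
    and basis: "lagrange_basis \<Omega> \<G> T F p \<theta>"
    and quadrature: "quadrature_rule \<G> \<theta> amax q \<omega>"
    and Pext: "linear Pext"
    and dn: "\<forall>i. dn$i \<in> {0..1}"
    and U: "U \<in> effective_domain \<J>"
    and stationary:
      "\<forall>j. (\<forall>V\<in>V_displacement j. \<J> U \<le> \<J> (U + V)) \<and> (\<forall>V\<in>V_damage j. \<J> U \<le> \<J> (U + V))"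
  shows "\<J>\<^sub>0 differentiable (at U within damage_box) \<and>
    (\<forall>W\<in>effective_domain \<J>. gradient \<J>\<^sub>0 (at U within damage_box) \<bullet> (W - U) \<ge> 0)"
  proof -
  have U': "\<forall>i. snd U $ i \<in> {dn$i..1}"
    using U unfolding \<J>_def effective_domain_functional_J by simp
  then have box: "U \<in> damage_box"
    using dn by (auto simp: damage_box_def split_beta intro: order_trans)
  have diff: "\<J>\<^sub>0 differentiable (at U within damage_box)"
    unfolding \<J>\<^sub>0_def \<psi>_def \<gamma>_def
    using domain quadrature
    by (intro J0_differentiable[OF grid basis] g Pext box) (auto simp: polyhedral_domain_def quadrature_rule_def)
  then obtain D where D: "(\<J>\<^sub>0 has_derivative D) (at U within damage_box)"
    unfolding differentiable_def by blast
  obtain G where G: "D = (\<lambda>h. G \<bullet> h)"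
    using linear_functional_inner has_derivative_linear[OF D] by blast
  have "gradient \<J>\<^sub>0 (at U within damage_box) = G"
    using D unfolding G by (intro gradient_eq_within_convex damage_box_convex_body box)
  moreover have "D (W - U) \<ge> 0" if W: "W \<in> effective_domain \<J>" for W
  proof (rule blockwise_stationary_imp_first_order[OF _ D U[unfolded \<J>_def] _ _ W[unfolded \<J>_def]])
    show "0 \<le> dn $ i" for i using dn by simp
    show "functional_J \<J>\<^sub>0 dn U \<le> functional_J \<J>\<^sub>0 dn (U + V)" if "V \<in> V_displacement j" for j V
      using stationary that unfolding \<J>_def by blast
    show "functional_J \<J>\<^sub>0 dn U \<le> functional_J \<J>\<^sub>0 dn (U + V)" if "V \<in> V_damage j" for j V
      using stationary that unfolding \<J>_def by blast
  qed
  ultimately show ?thesis using diff G by simp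
qed

end
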